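(* Let $n\geq 2$, and let $M$ be the monoid of all planar partitions $\alpha\in\mathcal{PP}_n$ such that $1$ and $1'$ belong to the same block of $\alpha$. Let $Q=\{\varepsilon\in P(M):\operatorname{rank}(\varepsilon)\in\{1,2\}\}$, let $Q^-=Q\cup\{-\}$ where $-$ is a symbol not in $Q$, and let $\mu:Q^-\times M\to Q^-$ be the action given by $$\mu(\varepsilon,\alpha)=\begin{cases}\alpha^*\varepsilon\alpha&\text{if $\varepsilon\in Q$ and $\ker(\varepsilon)=\ker(\varepsilon\alpha)$}\\ -&\text{otherwise.}\end{cases}$$ Then $\mu$ is faithful and monogenic, and consequently $$\deg(M)\leq\deg_{\mathrm{rc}}(M)\leq 1+|Q|.$$
   Context: Diagram monoids. For an integer $n\ge 0$ let $\mathbf n=\{1,\dots,n\}$ and $\mathbf n'=\{1',\dots,n'\}$. The partition monoid $\mathcal P_n$ is the set of all set partitions of $\mathbf n\cup\mathbf n'$. Product of $\alpha,\beta\in\mathcal P_n$: with $\mathbf n''=\{1'',\dots,n''\}$, rename each $x'$ in $\alpha$ as $x''$ and each (unprimed) $x$ in $\beta$ as $x''$; consider the equivalence on $\mathbf n\cup\mathbf n''\cup\mathbf n'$ generated by the blocks of these two renamed partitions; $x,y\in\mathbf n\cup\mathbf n'$ are in the same block of $\alpha\beta$ iff they are related by this equivalence. This is a monoid with identity the partition with blocks $\{x,x'\}$. $\alpha^*$ is obtained from $\alpha$ by interchanging $x$ and $x'$ for all $x$. $\operatorname{rank}(\alpha)$ is the number of blocks of $\alpha$ meeting both $\mathbf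 n$ and $\mathbf n'$. $\ker(\alpha)=\{(x,y)\in\mathbf n\times\mathbf n: x,y\text{ lie in the same block of }\alpha\}$. $\alpha$ is planar if it can be drawn by a graph, whose connected components are the blocks, with vertices $1,\dots,n$ in order on an upper row and $1',\dots,n'$ in order on a lower row, with all edges inside the rectangle spanned by the vertices and with no crossings (equivalently, $\alpha$ is a non-crossing partition for the cyclic order $1,\dots,n,n',\dots,1'$). $\mathcal{PP}_n$ is the submonoid of planar partitions. $P(M)=\{\varepsilon\in M:\varepsilon^2=\varepsilon=\varepsilon^*\}$ is the set of projections. ($M$ is isomorphic to the Temperley--Lieb monoid $\mathcal{TL}_{2n-1}$ of planar partitions in $\mathcal P_{2n-1}$ with all blocks of size $2$.) Actions. A right action of a semigroup $S$ on $X$ is a map $\mu:X\times S\to X$ with $\mu(\mu(x,a),b)=\mu(x,ab)$. It is faithful if distinct elements of $S$ induce distinct maps $X\to X$. It is monogenic if for some $x\in X$ we have $X=\{x\}\cup\{\mu(x,a):a\in S\}$. Degrees. For a finite semigroup $S$, $\deg(S)$ is the least $m\geq1$ such that $S$ embeds (via an injective semigroup homomorphism) in the monoid $\mathcal T_m$ of all self-maps of $\{1,\dots,m\}$ composed left to right. A right congruence $\sigma$ on $S$ is an equivalence with $(a,b)\in\sigma\Rightarrow(as,bs)\in\sigma$ for all $s \in S$; it gives an action of $S$ on $S/\sigma$ by $([x]_\sigma,a)\mapsto[xa]_\sigma$. $\deg_{\mathrm{rc}}(S)$ is the minimum of $|S/\sigma|$ over right congruences $\sigma$ whose associated action is faithful.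 *)

theory Defs
  imports "HOL-Library.Disjoint_Sets" "HOL-Algebra.Group"
begin

text \<open>\<open>Upper x\<close>, \<open>Lower x\<close>, \<open>Middle x\<close> stand for the vertices written x, x', x'' on paper.
  Middle vertices occur only in the definition of the product.\<close>

datatype vertex = Upper nat | Middle nat | Lower nat

type_synonym partition = "vertex set set"

definition vertices :: "nat \<Rightarrow> vertex set" where
  "vertices n = Upper ` {1..n} \<union> Lower ` {1..n}"

definition same_block :: "partition \<Rightarrow> vertex \<Rightarrow> vertex \<Rightarrow> bool" where
  "same_block \<alpha> x y \<longleftrightarrow> (\<exists>A\<in>\<alpha>. x \<in> A \<and> y \<in> A)"

fun lower_to_middle :: "vertex \<Rightarrow> vertex" where
  "lower_to_middle (Lower x) = Middle x"
| "lower_to_middle v = v"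

fun upper_to_middle :: "vertex \<Rightarrow> vertex" where
  "upper_to_middle (Upper x) = Middle x"
| "upper_to_middle v = v"

fun flip_vertex :: "vertex \<Rightarrow> vertex" where
  "flip_vertex (Upper x) = Lower x"
| "flip_vertex (Lower x) = Upper x"
| "flip_vertex (Middle x) = Middle x"

definition rename :: "(vertex \<Rightarrow> vertex) \<Rightarrow> partition \<Rightarrow> partition" where
  "rename f \<alpha> = (`) f ` \<alpha>"

definition product_equiv :: "partition \<Rightarrow> partition \<Rightarrow> vertex \<Rightarrow> vertex \<Rightarrow> bool" where
  "product_equiv \<alpha> \<beta> =
     equivclp (same_block (rename lower_to_middle \<alpha> \<union> rename upper_to_middle \<beta>))"

definition partition_mult :: "nat \<Rightarrow> partition \<Rightarrow> partition \<Rightarrow> partition" where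
  "partition_mult n \<alpha> \<beta> =
     vertices n // {(x, y). x \<in> vertices n \<and> y \<in> vertices n \<and> product_equiv \<alpha> \<beta> x y}"

definition partition_one :: "nat \<Rightarrow> partition" where
  "partition_one n = {{Upper x, Lower x} | x. x \<in> {1..n}}"

definition partition_monoid :: "nat \<Rightarrow> partition monoid" where
  "partition_monoid n =
     \<lparr>carrier = {\<alpha>. partition_on (vertices n) \<alpha>},
      mult = partition_mult n,
      one = partition_one n\<rparr>"

definition star :: "partition \<Rightarrow> partition" where
  "star \<alpha> = rename flip_vertex \<alpha>"

definition rank :: "partition \<Rightarrow> nat" where
  "rank \<alpha> = card {A \<in> \<alpha>. (\<exists>x. Upper x \<in> A) \<and> (\<exists>y. Lower y \<in> A)}"

definition ker :: "partition \<Rightarrow> (nat \<times> nat) set" where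
  "ker \<alpha> = {(x, y). same_block \<alpha> (Upper x) (Upper y)}"

text \<open>\<open>boundary_pos n\<close> numbers the vertices in the cyclic order 1, ..., n, n', ..., 1' in which
  they occur around the rectangle. Cutting this cyclic order between 1' and 1 does not affect
  the notion of crossing, as it is symmetric in the two blocks involved.\<close>

fun boundary_pos :: "nat \<Rightarrow> vertex \<Rightarrow> nat" where
  "boundary_pos n (Upper x) = x"
| "boundary_pos n (Lower x) = 2 * n + 1 - x"
| "boundary_pos n (Middle x) = 0"

definition planar :: "nat \<Rightarrow> partition \<Rightarrow> bool" where
  "planar n \<alpha> \<longleftrightarrow>
     \<not> (\<exists>A\<in>\<alpha>. \<exists>B\<in>\<alpha>. A \<noteq> B \<and>
          (\<exists>a\<in>A. \<exists>b\<in>B. \<exists>c\<in>A. \<exists>d\<in>B.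
             boundary_pos n a < boundary_pos n b \<and>
             boundary_pos n b < boundary_pos n c \<and>
             boundary_pos n c < boundary_pos n d))"

definition planar_partition_monoid :: "nat \<Rightarrow> partition monoid" where
  "planar_partition_monoid n =
     (partition_monoid n) \<lparr>carrier := {\<alpha> \<in> carrier (partition_monoid n). planar n \<alpha>}\<rparr>"

definition projections :: "(partition, 'b) monoid_scheme \<Rightarrow> partition set" where
  "projections M = {\<epsilon> \<in> carrier M. \<epsilon> \<otimes>\<^bsub>M\<^esub> \<epsilon> = \<epsilon> \<and> star \<epsilon> = \<epsilon>}"

definition right_action ::
    "('a, 'b) monoid_scheme \<Rightarrow> 'x set \<Rightarrow> ('x \<Rightarrow> 'a \<Rightarrow> 'x) \<Rightarrow> bool" where
  "right_action S X \<mu> \<longleftrightarrow>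
     \<mu> \<in> X \<rightarrow> carrier S \<rightarrow> X \<and>
     (\<forall>x\<in>X. \<forall>a\<in>carrier S. \<forall>b\<in>carrier S. \<mu> (\<mu> x a) b = \<mu> x (a \<otimes>\<^bsub>S\<^esub> b))"

definition faithful ::
    "('a, 'b) monoid_scheme \<Rightarrow> 'x set \<Rightarrow> ('x \<Rightarrow> 'a \<Rightarrow> 'x) \<Rightarrow> bool" where
  "faithful S X \<mu> \<longleftrightarrow> inj_on (\<lambda>a. \<lambda>x\<in>X. \<mu> x a) (carrier S)"

definition monogenic ::
    "('a, 'b) monoid_scheme \<Rightarrow> 'x set \<Rightarrow> ('x \<Rightarrow> 'a \<Rightarrow> 'x) \<Rightarrow> bool" where
  "monogenic S X \<mu> \<longleftrightarrow> (\<exists>x\<in>X. X = {x} \<union> {\<mu> x a | a. a \<in> carrier S})"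

definition full_transformation_monoid :: "nat \<Rightarrow> (nat \<Rightarrow> nat) monoid" where
  "full_transformation_monoid m =
     \<lparr>carrier = {1..m} \<rightarrow>\<^sub>E {1..m},
      mult = (\<lambda>f g. compose {1..m} g f),
      one = (\<lambda>x\<in>{1..m}. x)\<rparr>"

text \<open>Both degrees are meant for finite semigroups. The record \<open>S\<close> may be any semigroup: its
  unit plays no role in them (\<^const>\<open>mon\<close> is the set of injective multiplicative maps, which
  need not preserve units).\<close>

definition deg :: "('a, 'b) monoid_scheme \<Rightarrow> nat" where
  "deg S = (LEAST m. m \<ge> 1 \<and> mon S (full_transformation_monoid m) \<noteq> {})"

definition right_congruence :: "('a, 'b) monoid_scheme \<Rightarrow> ('a \<times> 'a) set \<Rightarrow> bool" where
  "right_congruence S \<sigma> \<longleftrightarrow>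
     equiv (carrier S) \<sigma> \<and>
     (\<forall>(a, b)\<in>\<sigma>. \<forall>s\<in>carrier S. (a \<otimes>\<^bsub>S\<^esub> s, b \<otimes>\<^bsub>S\<^esub> s) \<in> \<sigma>)"

text \<open>For a right congruence all classes in the following union coincide, so this sends the
  class of x to the class of xa.\<close>

definition class_action ::
    "('a, 'b) monoid_scheme \<Rightarrow> ('a \<times> 'a) set \<Rightarrow> 'a set \<Rightarrow> 'a \<Rightarrow> 'a set" where
  "class_action S \<sigma> C a = (\<Union>x\<in>C. \<sigma> `` {x \<otimes>\<^bsub>S\<^esub> a})"

definition deg_rc :: "('a, 'b) monoid_scheme \<Rightarrow> nat" where
  "deg_rc S =
     (LEAST k. \<exists>\<sigma>. right_congruence S \<sigma> \<and>
                   faithful S (carrier S // \<sigma>) (class_action S \<sigma>) \<and>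
                   k = card (carrier S // \<sigma>))"

definition M_monoid :: "nat \<Rightarrow> partition monoid" where
  "M_monoid n =
     (planar_partition_monoid n)
       \<lparr>carrier := {\<alpha> \<in> carrier (planar_partition_monoid n). same_block \<alpha> (Upper 1) (Lower 1)}\<rparr>"

definition Q_set :: "nat \<Rightarrow> partition set" where
  "Q_set n = {\<epsilon> \<in> projections (M_monoid n). rank \<epsilon> \<in> {1, 2}}"

text \<open>The additional symbol - is \<^const>\<open>None\<close>.\<close>

definition Q_minus :: "nat \<Rightarrow> partition option set" where
  "Q_minus n = Some ` Q_set n \<union> {None}"

definition mu :: "nat \<Rightarrow> partition option \<Rightarrow> partition \<Rightarrow> partition option" where
  "mu n x \<alpha> =
     (case x of
        Some \<epsilon> \<Rightarrow>
          if \<epsilon> \<in> Q_set n \<and> ker \<epsilon> = ker (\<epsilon> \<otimes>\<^bsub>M_monoid n\<^esub> \<alpha>)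
          then Some (star \<alpha> \<otimes>\<^bsub>M_monoid n\<^esub> \<epsilon> \<otimes>\<^bsub>M_monoid n\<^esub> \<alpha>)
          else None
      | None \<Rightarrow> None)"

end

theory Submission
  imports Defs
begin

text \<open>A monogenic faithful action on \<open>X\<close> is isomorphic to the action on the classes of the right
  congruence of elements that agree on the generator, so both inequalities follow from the statements
  on \<open>\<mu>\<close>. With \<open>\<gamma> = \<epsilon>\<alpha>\<close> we have \<open>\<alpha>*\<epsilon>\<alpha> = \<gamma>*\<gamma>\<close>, which is a projection because \<open>\<gamma>\<gamma>*\<gamma> = \<gamma>\<close>, and \<open>\<mu>\<close>
  is an action because equality of kernels is preserved by multiplication on the left.
  Let \<open>\<epsilon>\<close> have the blocks \<open>{1, i, 1', i'}\<close>, \<open>{j, j'}\<close> and singletons. Then \<open>\<alpha>\<close> sends \<open>\<epsilon>\<close> to - iff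
  \<open>j\<close> is in the block of \<open>1\<close> or \<open>i\<close> in \<open>\<alpha>\<close>, which determines the kernel of \<open>\<alpha>\<close>. For \<open>i = 1\<close>, the
  projection \<open>\<alpha>*\<epsilon>\<alpha>\<close> has the lower blocks of \<open>\<alpha>\<close>, and the transversal ones among them are those joined
  to \<open>1\<close> or \<open>j\<close> in \<open>\<alpha>\<close>. So \<open>\<mu>\<close> is faithful, and the projection for \<open>(i, j) = (1, 2)\<close> is a generator.\<close>

section \<open>Actions and degrees\<close>

lemma mon_full_transformation_monoid_if_faithful:
  assumes act: "right_action S X \<mu>" and faith: "faithful S X \<mu>" and "finite X"
    and closed: "\<And>a b. a \<in> carrier S \<Longrightarrow> b \<in> carrier S \<Longrightarrow> a \<otimes>\<^bsub>S\<^esub> b \<in> carrier S"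
  shows "mon S (full_transformation_monoid (card X)) \<noteq> {}"
proof -
  define m where "m = card X"
  obtain f where f: "bij_betw f {1..m} X"
    using ex_bij_betw_nat_finite_1[OF \<open>finite X\<close>] m_def by auto
  define g where "g = inv_into {1..m} f"
  have fX: "f i \<in> X" if "i \<in> {1..m}" for i using f that by (auto simp: bij_betw_def)
  have gX: "g x \<in> {1..m}" if "x \<in> X" for x
    using f that unfolding g_def by (metis bij_betw_def inv_into_into)
  have fg: "f (g x) = x" if "x \<in> X" for x
    using f that unfolding g_def by (metis bij_betw_def f_inv_into_f)
  have muX: "\<mu> x a \<in> X" if "x \<in> X" "a \<in> carrier S" for x a
    using act that unfolding right_action_def by blast
  have mu_mult: "\<mu> (\<mu> x a) b = \<mu> x (a \<otimes>\<^bsub>S\<^esub> b)"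
    if "x \<in> X" "a \<in> carrier S" "b \<in> carrier S" for x a b
    using act that unfolding right_action_def by blast
  define h where "h = (\<lambda>a. \<lambda>i\<in>{1..m}. g (\<mu> (f i) a))"
  have "h \<in> hom S (full_transformation_monoid m)"
  proof (rule homI)
    fix a assume "a \<in> carrier S"
    then show "h a \<in> carrier (full_transformation_monoid m)"
      unfolding h_def full_transformation_monoid_def using gX muX fX by auto
  next
    fix a b assume ab: "a \<in> carrier S" "b \<in> carrier S"
    have "g (\<mu> (f i) (a \<otimes>\<^bsub>S\<^esub> b)) = g (\<mu> (f (g (\<mu> (f i) a))) b)" if "i \<in> {1..m}" for i
      using that ab by (simp add: fg fX muX mu_mult)
    then show "h (a \<otimes>\<^bsub>S\<^esub> b) = h a \<otimes>\<^bsub>full_transformation_monoid m\<^esub> h b"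
      using ab gX muX fX
      by (auto simp: h_def full_transformation_monoid_def compose_def intro!: restrict_ext)
  qed
  moreover have "inj_on h (carrier S)"
  proof (rule inj_onI)
    fix a b assume ab: "a \<in> carrier S" "b \<in> carrier S" and eq: "h a = h b"
    have "\<mu> x a = \<mu> x b" if "x \<in> X" for x
    proof -
      have "g (\<mu> (f (g x)) a) = g (\<mu> (f (g x)) b)"
        using fun_cong[OF eq, of "g x"] gX[OF that] by (simp add: h_def)
      then show ?thesis using that ab fg muX by metis
    qed
    then have "(\<lambda>x\<in>X. \<mu> x a) = (\<lambda>x\<in>X. \<mu> x b)" by (rule restrict_ext)
    then show "a = b"
      using faith ab unfolding faithful_def inj_on_def by blast
  qed
  ultimately show ?thesis unfolding mon_def m_def by blast
qed

lemma class_action_class: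
  assumes "right_congruence S \<sigma>" "x \<in> carrier S" "a \<in> carrier S"
  shows "class_action S \<sigma> (\<sigma> `` {x}) a = \<sigma> `` {x \<otimes>\<^bsub>S\<^esub> a}"
proof -
  have eq: "equiv (carrier S) \<sigma>" using assms(1) unfolding right_congruence_def by blast
  have "\<sigma> `` {y \<otimes>\<^bsub>S\<^esub> a} = \<sigma> `` {x \<otimes>\<^bsub>S\<^esub> a}" if "y \<in> \<sigma> `` {x}" for y
  proof -
    have "(x \<otimes>\<^bsub>S\<^esub> a, y \<otimes>\<^bsub>S\<^esub> a) \<in> \<sigma>"
      using assms(1,3) that unfolding right_congruence_def by blast
    then show ?thesis using equiv_class_eq[OF eq] by blast
  qed
  moreover have "x \<in> \<sigma> `` {x}" using eq assms(2) by (meson equiv_class_self)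
  ultimately show ?thesis unfolding class_action_def by blast
qed

lemma right_action_class_action:
  assumes "monoid S" "right_congruence S \<sigma>"
  shows "right_action S (carrier S // \<sigma>) (class_action S \<sigma>)"
  unfolding right_action_def
proof (intro conjI ballI funcsetI)
  fix C a assume "C \<in> carrier S // \<sigma>" "a \<in> carrier S"
  then show "class_action S \<sigma> C a \<in> carrier S // \<sigma>"
    using class_action_class[OF assms(2)] monoid.m_closed[OF assms(1)]
    by (auto elim!: quotientE intro!: quotientI)
next
  fix C a b assume "C \<in> carrier S // \<sigma>" "a \<in> carrier S" "b \<in> carrier S"
  then show "class_action S \<sigma> (class_action S \<sigma> C a) b = class_action S \<sigma> C (a \<otimes>\<^bsub>S\<^esub> b)"
    using class_action_class[OF assms(2)] monoid.m_closed[OF assms(1)] monoid.m_assoc[OF assms(1)]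
    by (auto elim!: quotientE)
qed

lemma deg_le_deg_rc:
  assumes "monoid S" "finite (carrier S)"
    and "right_congruence S \<tau>" "faithful S (carrier S // \<tau>) (class_action S \<tau>)"
  shows "deg S \<le> deg_rc S"
proof -
  have "\<exists>\<sigma>. right_congruence S \<sigma> \<and> faithful S (carrier S // \<sigma>) (class_action S \<sigma>) \<and>
      deg_rc S = card (carrier S // \<sigma>)"
    unfolding deg_rc_def by (rule LeastI) (use assms(3,4) in blast)
  then obtain \<sigma> where \<sigma>: "right_congruence S \<sigma>" "faithful S (carrier S // \<sigma>) (class_action S \<sigma>)"
    and card: "deg_rc S = card (carrier S // \<sigma>)" by blast
  have "\<sigma> \<subseteq> carrier S \<times> carrier S"
    using \<sigma>(1) unfolding right_congruence_def equiv_def refl_on_def by blast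
  then have fin: "finite (carrier S // \<sigma>)" using assms(2) by (rule finite_quotient[rotated])
  moreover have "carrier S // \<sigma> \<noteq> {}"
    using monoid.one_closed[OF assms(1)] unfolding quotient_def by blast
  ultimately have "1 \<le> deg_rc S" using card by (simp add: Suc_leI card_gt_0_iff)
  moreover have "mon S (full_transformation_monoid (deg_rc S)) \<noteq> {}"
    unfolding card using right_action_class_action[OF assms(1) \<sigma>(1)] \<sigma>(2) fin
    by (rule mon_full_transformation_monoid_if_faithful) (rule monoid.m_closed[OF assms(1)])
  ultimately show ?thesis unfolding deg_def by (intro Least_le conjI)
qed

lemma ex_faithful_right_congruence:
  assumes "monoid S" and act: "right_action S X \<mu>" and faith: "faithful S X \<mu>" and "finite X"
    and "x \<in> X" and orbit: "X = \<mu> x ` carrier S"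
  obtains \<sigma> where "right_congruence S \<sigma>" "faithful S (carrier S // \<sigma>) (class_action S \<sigma>)"
    "card (carrier S // \<sigma>) \<le> card X"
proof -
  interpret monoid S by fact
  define \<sigma> where "\<sigma> = {(a, b). a \<in> carrier S \<and> b \<in> carrier S \<and> \<mu> x a = \<mu> x b}"
  have mu_mult: "\<mu> (\<mu> y a) b = \<mu> y (a \<otimes>\<^bsub>S\<^esub> b)"
    if "y \<in> X" "a \<in> carrier S" "b \<in> carrier S" for y a b
    using act that unfolding right_action_def by blast
  have eq: "equiv (carrier S) \<sigma>"
    unfolding \<sigma>_def by (auto intro!: equivI refl_onI symI transI)
  have cong: "right_congruence S \<sigma>"
    unfolding right_congruence_def
  proof (intro conjI eq, clarify)
    fix a b s assume "(a, b) \<in> \<sigma>" "s \<in> carrier S"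
    moreover from this have "\<mu> x (a \<otimes>\<^bsub>S\<^esub> s) = \<mu> x (b \<otimes>\<^bsub>S\<^esub> s)"
      using mu_mult[OF \<open>x \<in> X\<close>, symmetric] unfolding \<sigma>_def by simp
    ultimately show "(a \<otimes>\<^bsub>S\<^esub> s, b \<otimes>\<^bsub>S\<^esub> s) \<in> \<sigma>"
      unfolding \<sigma>_def by simp
  qed
  have "faithful S (carrier S // \<sigma>) (class_action S \<sigma>)"
    unfolding faithful_def
  proof (rule inj_onI)
    fix a b assume ab: "a \<in> carrier S" "b \<in> carrier S"
      and eq_ab: "(\<lambda>C\<in>carrier S // \<sigma>. class_action S \<sigma> C a) = (\<lambda>C\<in>carrier S // \<sigma>. class_action S \<sigma> C b)"
    have "\<mu> y a = \<mu> y b" if "y \<in> X" for y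
    proof -
      have "y \<in> \<mu> x ` carrier S" using that orbit by simp
      then obtain c where c: "c \<in> carrier S" "y = \<mu> x c" by blast
      have "\<sigma> `` {c \<otimes>\<^bsub>S\<^esub> a} = \<sigma> `` {c \<otimes>\<^bsub>S\<^esub> b}"
        using fun_cong[OF eq_ab, of "\<sigma> `` {c}"] c(1) class_action_class[OF cong c(1)] ab
        by (simp add: quotientI)
      then have "(c \<otimes>\<^bsub>S\<^esub> a, c \<otimes>\<^bsub>S\<^esub> b) \<in> \<sigma>"
        using eq ab c by (meson eq_equiv_class m_closed)
      then show ?thesis using c ab \<open>x \<in> X\<close> mu_mult unfolding \<sigma>_def by auto
    qed
    then have "(\<lambda>y\<in>X. \<mu> y a) = (\<lambda>y\<in>X. \<mu> y b)" by (rule restrict_ext)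
    then show "a = b" using faith ab unfolding faithful_def inj_on_def by blast
  qed
  moreover have "carrier S // \<sigma> \<subseteq> (\<lambda>y. {a \<in> carrier S. \<mu> x a = y}) ` X"
  proof
    fix C assume "C \<in> carrier S // \<sigma>"
    then obtain c where c: "c \<in> carrier S" "C = \<sigma> `` {c}" by (rule quotientE)
    then have "C = {a \<in> carrier S. \<mu> x a = \<mu> x c}" unfolding \<sigma>_def by auto
    moreover have "\<mu> x c \<in> X" using c(1) orbit by simp
    ultimately show "C \<in> (\<lambda>y. {a \<in> carrier S. \<mu> x a = y}) ` X" by (rule image_eqI)
  qed
  then have "card (carrier S // \<sigma>) \<le> card X"
    using \<open>finite X\<close> by (rule surj_card_le[rotated])
  ultimately show ?thesis using cong that by blast
qed

section \<open>Products of partitions as path relations\<close>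

lemma block_unique:
  assumes "partition_on X \<alpha>" "A \<in> \<alpha>" "B \<in> \<alpha>" "u \<in> A" "u \<in> B"
  shows "A = B"
  using assms by (metis partition_onD2 disjointD disjoint_iff)

lemma same_block_sym: "same_block \<alpha> u v \<Longrightarrow> same_block \<alpha> v u"
  by (auto simp: same_block_def)

lemma same_block_trans:
  assumes "partition_on A \<alpha>" "same_block \<alpha> u v" "same_block \<alpha> v w"
  shows "same_block \<alpha> u w"
  using assms unfolding same_block_def partition_on_def disjoint_def by blast

lemma same_block_dom:
  assumes "partition_on A \<alpha>" "same_block \<alpha> u v"
  shows "u \<in> A" "v \<in> A"
  using assms unfolding same_block_def partition_on_def by auto

lemma same_block_refl: "partition_on A \<alpha> \<Longrightarrow> u \<in> A \<Longrightarrow> same_block \<alpha> u u"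
  unfolding same_block_def partition_on_def by auto

lemma partition_eqI:
  assumes "partition_on A \<alpha>" "partition_on A \<beta>" "\<And>u v. same_block \<alpha> u v \<longleftrightarrow> same_block \<beta> u v"
  shows "\<alpha> = \<beta>"
proof -
  have "\<alpha> = A // {(u, v). same_block \<alpha> u v}" "\<beta> = A // {(u, v). same_block \<beta> u v}"
    using partition_on_eq_quotient assms(1,2) unfolding same_block_def by blast+
  then show ?thesis using assms(3) by simp
qed

lemma same_block_quotient:
  assumes "equiv A r"
  shows "same_block (A // r) u v \<longleftrightarrow> (u, v) \<in> r"
proof
  assume "same_block (A // r) u v"
  then show "(u, v) \<in> r" unfolding same_block_def using quotient_eq_iff[OF assms] by blast
next
  assume "(u, v) \<in> r"
  moreover from this have "u \<in> A" using assms by (auto simp: equiv_def refl_on_def)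
  ultimately have "r `` {u} \<in> A // r" "u \<in> r `` {u}" "v \<in> r `` {u}"
    using equiv_class_self[OF assms] by (auto intro: quotientI)
  then show "same_block (A // r) u v" unfolding same_block_def by blast
qed

lemma same_block_rename:
  "same_block (rename f \<alpha>) x y \<longleftrightarrow> (\<exists>u v. same_block \<alpha> u v \<and> x = f u \<and> y = f v)"
  unfolding same_block_def rename_def by blast

lemma same_block_Un: "same_block (\<alpha> \<union> \<beta>) x y \<longleftrightarrow> same_block \<alpha> x y \<or> same_block \<beta> x y"
  unfolding same_block_def by blast

lemma equiv_product_equiv:
  "equiv (vertices n) {(x, y). x \<in> vertices n \<and> y \<in> vertices n \<and> product_equiv \<alpha> \<beta> x y}"
  unfolding product_equiv_def
  by (auto intro!: equivI refl_onI symI transI intro: equivclp_sym equivclp_trans)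

lemma partition_on_mult: "partition_on (vertices n) (partition_mult n \<alpha> \<beta>)"
  unfolding partition_mult_def by (rule partition_on_quotient[OF equiv_product_equiv])

lemma same_block_mult_iff:
  "same_block (partition_mult n \<alpha> \<beta>) u v \<longleftrightarrow>
     u \<in> vertices n \<and> v \<in> vertices n \<and> product_equiv \<alpha> \<beta> u v"
  unfolding partition_mult_def same_block_quotient[OF equiv_product_equiv] by simp

text \<open>Several factors are stacked by putting the vertices of a partition on rows \<open>i\<close> and \<open>j\<close>.\<close>

fun place :: "nat \<Rightarrow> nat \<Rightarrow> vertex \<Rightarrow> nat \<times> nat" where
  "place i j (Upper x) = (i, x)"
| "place i j (Lower x) = (j, x)"
| "place i j (Middle x) = (Suc (i + j), x)"

definition edges :: "nat \<Rightarrow> nat \<Rightarrow> partition \<Rightarrow> ((nat \<times> nat) \<times> (nat \<times> nat)) set" where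
  "edges i j \<alpha> = {(place i j u, place i j v) | u v. same_block \<alpha> u v}"

lemma edgesI: "same_block \<alpha> u v \<Longrightarrow> (place i j u, place i j v) \<in> edges i j \<alpha>"
  unfolding edges_def by blast

lemma edges_sym: "(p, q) \<in> edges i j \<alpha> \<Longrightarrow> (q, p) \<in> edges i j \<alpha>"
  unfolding edges_def using same_block_sym by blast

lemma vertex_cases [consumes 1, case_names Upper Lower]:
  assumes "u \<in> vertices n"
  obtains x where "u = Upper x" "x \<in> {1..n}" | x where "u = Lower x" "x \<in> {1..n}"
  using assms unfolding vertices_def by auto

lemma Upper_in_vertices [simp]: "Upper x \<in> vertices n \<longleftrightarrow> x \<in> {1..n}"
  and Lower_in_vertices [simp]: "Lower x \<in> vertices n \<longleftrightarrow> x \<in> {1..n}"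
  and Middle_in_vertices [simp]: "Middle x \<notin> vertices n"
  unfolding vertices_def by auto

lemma partition_eqI_rows:
  assumes "partition_on (vertices n) \<alpha>" "partition_on (vertices n) \<beta>"
    and upper: "\<And>a b. a \<in> {1..n} \<Longrightarrow> b \<in> {1..n} \<Longrightarrow>
      same_block \<alpha> (Upper a) (Upper b) \<longleftrightarrow> same_block \<beta> (Upper a) (Upper b)"
    and lower: "\<And>a b. a \<in> {1..n} \<Longrightarrow> b \<in> {1..n} \<Longrightarrow>
      same_block \<alpha> (Lower a) (Lower b) \<longleftrightarrow> same_block \<beta> (Lower a) (Lower b)"
    and link: "\<And>a b. a \<in> {1..n} \<Longrightarrow> b \<in> {1..n} \<Longrightarrow>
      same_block \<alpha> (Upper a) (Lower b) \<longleftrightarrow> same_block \<beta> (Upper a) (Lower b)"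
  shows "\<alpha> = \<beta>"
proof (rule partition_eqI[OF assms(1,2)])
  fix u v
  show "same_block \<alpha> u v \<longleftrightarrow> same_block \<beta> u v"
  proof (cases "u \<in> vertices n \<and> v \<in> vertices n")
    case True
    moreover have "same_block \<alpha> (Lower a) (Upper b) \<longleftrightarrow> same_block \<beta> (Lower a) (Upper b)"
      if "a \<in> {1..n}" "b \<in> {1..n}" for a b
      using link[OF that(2,1)] same_block_sym by blast
    ultimately show ?thesis using upper lower link by (auto elim!: vertex_cases)
  next
    case False
    then show ?thesis using same_block_dom[OF assms(1)] same_block_dom[OF assms(2)] by blast
  qed
qed

lemma place_eq_iff:
  "i \<noteq> j \<Longrightarrow> u \<in> vertices n \<Longrightarrow> v \<in> vertices n \<Longrightarrow> place i j u = place i j v \<longleftrightarrow> u = v"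
  by (cases u; cases v) auto

lemma edges_trans:
  assumes "partition_on (vertices n) \<alpha>" "i \<noteq> j" "(p, q) \<in> edges i j \<alpha>" "(q, r) \<in> edges i j \<alpha>"
  shows "(p, r) \<in> edges i j \<alpha>"
proof -
  obtain u v v' w where "same_block \<alpha> u v" "same_block \<alpha> v' w" "p = place i j u" "q = place i j v"
    "q = place i j v'" "r = place i j w"
    using assms(3,4) unfolding edges_def by blast
  moreover from this have "v = v'" using place_eq_iff[OF assms(2)] same_block_dom[OF assms(1)] by metis
  ultimately show ?thesis using same_block_trans[OF assms(1)] edgesI by metis
qed

fun row :: "nat \<Rightarrow> nat \<Rightarrow> nat \<Rightarrow> vertex \<Rightarrow> nat \<times> nat" where
  "row i j k (Upper x) = (i, x)"
| "row i j k (Middle x) = (j, x)"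
| "row i j k (Lower x) = (k, x)"

lemma product_equiv_iff:
  assumes "partition_on (vertices n) \<alpha>" "partition_on (vertices n) \<beta>" "i \<noteq> j" "j \<noteq> k" "i \<noteq> k"
  shows "product_equiv \<alpha> \<beta> u v \<longleftrightarrow> (row i j k u, row i j k v) \<in> (edges i j \<alpha> \<union> edges j k \<beta>)\<^sup>*"
proof -
  define r where "r = same_block (rename lower_to_middle \<alpha> \<union> rename upper_to_middle \<beta>)"
  have "symp r" unfolding r_def by (auto intro!: sympI simp: same_block_sym)
  then have prod: "product_equiv \<alpha> \<beta> = r\<^sup>*\<^sup>*"
    unfolding product_equiv_def r_def[symmetric] equivclp_def by (simp add: symp_symclp_eq)
  have "inj (row i j k)"
  proof (rule injI)
    fix u v assume "row i j k u = row i j k v"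
    then show "u = v" using assms(3-5) by (cases u; cases v) auto
  qed
  moreover have place_\<alpha>: "place i j u = row i j k (lower_to_middle u)" if "u \<in> vertices n" for u
    using that by (cases rule: vertex_cases) auto
  have place_\<beta>: "place j k u = row i j k (upper_to_middle u)" if "u \<in> vertices n" for u
    using that by (cases rule: vertex_cases) auto
  have "edges i j \<alpha> = {(row i j k x, row i j k y) | x y. same_block (rename lower_to_middle \<alpha>) x y}"
    unfolding edges_def same_block_rename using place_\<alpha> same_block_dom[OF assms(1)]
    by (smt (verit) Collect_cong)
  moreover have "edges j k \<beta> = {(row i j k x, row i j k y) | x y. same_block (rename upper_to_middle \<beta>) x y}"
    unfolding edges_def same_block_rename using place_\<beta> same_block_dom[OF assms(2)]
    by (smt (verit) Collect_cong)
  ultimately have E: "edges i j \<alpha> \<union> edges j k \<beta> = {(row i j k x, row i j k y) | x y. r x y}"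
    unfolding r_def same_block_Un by blast
  show ?thesis
  proof
    assume "product_equiv \<alpha> \<beta> u v"
    then show "(row i j k u, row i j k v) \<in> (edges i j \<alpha> \<union> edges j k \<beta>)\<^sup>*"
      unfolding prod
    proof induction
      case (step y z)
      then have "(row i j k y, row i j k z) \<in> edges i j \<alpha> \<union> edges j k \<beta>" unfolding E by blast
      with step.IH show ?case by (rule rtrancl_into_rtrancl)
    qed simp
  next
    have "\<exists>v. q = row i j k v \<and> r\<^sup>*\<^sup>* u v"
      if "(row i j k u, q) \<in> (edges i j \<alpha> \<union> edges j k \<beta>)\<^sup>*" for q
      using that
    proof induction
      case (step y z)
      then obtain v where v: "y = row i j k v" "r\<^sup>*\<^sup>* u v" by blast
      obtain v' w where "y = row i j k v'" "z = row i j k w" "r v' w" using step.hyps(2) E by blast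
      with v show ?case using injD[OF \<open>inj (row i j k)\<close>] by (metis rtranclp.rtrancl_into_rtrancl)
    qed blast
    moreover assume "(row i j k u, row i j k v) \<in> (edges i j \<alpha> \<union> edges j k \<beta>)\<^sup>*"
    ultimately show "product_equiv \<alpha> \<beta> u v"
      unfolding prod using injD[OF \<open>inj (row i j k)\<close>] by metis
  qed
qed

lemma same_block_mult:
  assumes "partition_on (vertices n) \<alpha>" "partition_on (vertices n) \<beta>" "i \<noteq> j" "j \<noteq> k" "i \<noteq> k"
    and "u \<in> vertices n" "v \<in> vertices n"
  shows "same_block (partition_mult n \<alpha> \<beta>) u v \<longleftrightarrow>
     (place i k u, place i k v) \<in> (edges i j \<alpha> \<union> edges j k \<beta>)\<^sup>*"
proof -
  have "place i k w = row i j k w" if "w \<in> vertices n" for w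
    using that by (cases rule: vertex_cases) auto
  then show ?thesis
    using same_block_mult_iff product_equiv_iff[OF assms(1-5)] assms(6,7) by simp
qed

text \<open>A path that leaves \<open>W\<close> uses only edges from \<open>R\<close> until it returns to \<open>W\<close>.\<close>

lemma rtrancl_hide:
  assumes "(p, q) \<in> (R \<union> T)\<^sup>*" "p \<in> W" "q \<in> W" "T \<subseteq> W \<times> W" "R\<^sup>* \<inter> W \<times> W \<subseteq> S\<^sup>*"
  shows "(p, q) \<in> (S \<union> T)\<^sup>*"
proof -
  have S: "S\<^sup>* \<subseteq> (S \<union> T)\<^sup>*" by (simp add: rtrancl_mono)
  have "\<exists>w\<in>W. (p, w) \<in> (S \<union> T)\<^sup>* \<and> (w, q) \<in> R\<^sup>*" using assms(1)
  proof induction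
    case base
    show ?case using \<open>p \<in> W\<close> by blast
  next
    case (step y z)
    then obtain w where w: "w \<in> W" "(p, w) \<in> (S \<union> T)\<^sup>*" "(w, y) \<in> R\<^sup>*" by blast
    show ?case
    proof (cases "(y, z) \<in> R")
      case True
      then show ?thesis using w by (meson rtrancl.rtrancl_into_rtrancl)
    next
      case False
      then have "(y, z) \<in> T" "y \<in> W" "z \<in> W" using step.hyps(2) assms(4) by auto
      moreover from this have "(w, y) \<in> (S \<union> T)\<^sup>*" using w S assms(5) by blast
      ultimately show ?thesis using w(2) by (meson UnCI rtrancl.rtrancl_refl rtrancl_into_rtrancl rtrancl_trans)
    qed
  qed
  then obtain w where "w \<in> W" "(p, w) \<in> (S \<union> T)\<^sup>*" "(w, q) \<in> R\<^sup>*" by blast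
  then show ?thesis using assms(3,5) S by (meson IntI SigmaI rtrancl_trans subsetD)
qed

lemma edges_subset:
  assumes "partition_on (vertices n) \<alpha>"
  shows "edges i j \<alpha> \<subseteq> ({i, j} \<times> {1..n}) \<times> ({i, j} \<times> {1..n})"
proof -
  have "place i j u \<in> {i, j} \<times> {1..n}" if "u \<in> vertices n" for u
    using that by (cases rule: vertex_cases) auto
  then show ?thesis unfolding edges_def using same_block_dom[OF assms] by blast
qed

lemma edges_mult_subset:
  assumes "partition_on (vertices n) \<alpha>" "partition_on (vertices n) \<beta>" "i \<noteq> j" "j \<noteq> k" "i \<noteq> k"
  shows "edges i k (partition_mult n \<alpha> \<beta>) \<subseteq> (edges i j \<alpha> \<union> edges j k \<beta>)\<^sup>*"
  using same_block_mult[OF assms] same_block_dom[OF partition_on_mult]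
  unfolding edges_def by blast

lemma rtrancl_edges_mult:
  assumes "partition_on (vertices n) \<alpha>" "partition_on (vertices n) \<beta>" "i \<noteq> j" "j \<noteq> k" "i \<noteq> k"
    and T: "T \<subseteq> {p. fst p \<noteq> j} \<times> {p. fst p \<noteq> j}" and "fst p \<noteq> j" "fst q \<noteq> j"
  shows "(p, q) \<in> (edges i k (partition_mult n \<alpha> \<beta>) \<union> T)\<^sup>* \<longleftrightarrow>
    (p, q) \<in> (edges i j \<alpha> \<union> edges j k \<beta> \<union> T)\<^sup>*" (is "?l \<longleftrightarrow> ?r")
proof
  let ?R = "edges i j \<alpha> \<union> edges j k \<beta>"
  have "edges i k (partition_mult n \<alpha> \<beta>) \<union> T \<subseteq> (?R \<union> T)\<^sup>*"
    using edges_mult_subset[OF assms(1-5)] rtrancl_mono[of ?R "?R \<union> T"] by blast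
  then show "?l \<Longrightarrow> ?r" by (metis rtrancl_mono rtrancl_idemp subsetD)
  have "?R\<^sup>* \<inter> {p. fst p \<noteq> j} \<times> {p. fst p \<noteq> j} \<subseteq> (edges i k (partition_mult n \<alpha> \<beta>))\<^sup>*"
  proof (intro subrelI)
    fix p q assume pq: "(p, q) \<in> ?R\<^sup>* \<inter> {p. fst p \<noteq> j} \<times> {p. fst p \<noteq> j}"
    show "(p, q) \<in> (edges i k (partition_mult n \<alpha> \<beta>))\<^sup>*"
    proof (cases "p = q")
      case False
      have R: "?R \<subseteq> ({i, j, k} \<times> {1..n}) \<times> ({i, j, k} \<times> {1..n})"
        using edges_subset[OF assms(1), of i j] edges_subset[OF assms(2), of j k] by blast
      have "(p, q) \<in> ?R\<^sup>+" using pq False by (auto dest: rtranclD)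
      then have "p \<in> {i, j, k} \<times> {1..n}" "q \<in> {i, j, k} \<times> {1..n}"
        using trancl_subset_Sigma[OF R] by auto
      then obtain x y l m where "p = (l, x)" "q = (m, y)" "l \<in> {i, k}" "m \<in> {i, k}" "x \<in> {1..n}" "y \<in> {1..n}"
        using pq by auto
      moreover have "\<exists>u\<in>vertices n. (l, x) = place i k u" if "l \<in> {i, k}" "x \<in> {1..n}" for l x
        using that by (auto intro: bexI[of _ "Upper x"] bexI[of _ "Lower x"])
      ultimately obtain u v where "u \<in> vertices n" "v \<in> vertices n" "p = place i k u" "q = place i k v"
        by metis
      then show ?thesis
        using pq same_block_mult[OF assms(1-5)] edgesI by blast
    qed simp
  qed
  then show "?r \<Longrightarrow> ?l" using rtrancl_hide[OF _ _ _ T] assms(7,8) by blast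
qed

lemma same_block_mult3:
  assumes "partition_on (vertices n) \<alpha>" "partition_on (vertices n) \<beta>" "partition_on (vertices n) \<gamma>"
    and "u \<in> vertices n" "v \<in> vertices n"
  shows "same_block (partition_mult n (partition_mult n \<alpha> \<beta>) \<gamma>) u v \<longleftrightarrow>
      (place 0 3 u, place 0 3 v) \<in> (edges 0 1 \<alpha> \<union> edges 1 2 \<beta> \<union> edges 2 3 \<gamma>)\<^sup>*"
    and "same_block (partition_mult n \<alpha> (partition_mult n \<beta> \<gamma>)) u v \<longleftrightarrow>
      (place 0 3 u, place 0 3 v) \<in> (edges 0 1 \<alpha> \<union> edges 1 2 \<beta> \<union> edges 2 3 \<gamma>)\<^sup>*"
proof -
  have fst: "fst (place 0 3 w) \<in> {0, 3}" if "w \<in> vertices n" for w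
    using that by (cases rule: vertex_cases) auto
  have "edges 2 3 \<gamma> \<subseteq> {p. fst p \<noteq> 1} \<times> {p. fst p \<noteq> 1}" using edges_subset[OF assms(3), of 2 3] by auto
  then have "(place 0 3 u, place 0 3 v) \<in> (edges 0 2 (partition_mult n \<alpha> \<beta>) \<union> edges 2 3 \<gamma>)\<^sup>* \<longleftrightarrow>
      (place 0 3 u, place 0 3 v) \<in> (edges 0 1 \<alpha> \<union> edges 1 2 \<beta> \<union> edges 2 3 \<gamma>)\<^sup>*"
    using assms fst[of u] fst[of v] by (intro rtrancl_edges_mult) auto
  then show "same_block (partition_mult n (partition_mult n \<alpha> \<beta>) \<gamma>) u v \<longleftrightarrow>
      (place 0 3 u, place 0 3 v) \<in> (edges 0 1 \<alpha> \<union> edges 1 2 \<beta> \<union> edges 2 3 \<gamma>)\<^sup>*"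
    using same_block_mult[OF partition_on_mult assms(3), of 0 2 3] assms(4,5) by simp
  have "edges 0 1 \<alpha> \<subseteq> {p. fst p \<noteq> 2} \<times> {p. fst p \<noteq> 2}" using edges_subset[OF assms(1), of 0 1] by auto
  then have "(place 0 3 u, place 0 3 v) \<in> (edges 1 3 (partition_mult n \<beta> \<gamma>) \<union> edges 0 1 \<alpha>)\<^sup>* \<longleftrightarrow>
      (place 0 3 u, place 0 3 v) \<in> (edges 1 2 \<beta> \<union> edges 2 3 \<gamma> \<union> edges 0 1 \<alpha>)\<^sup>*"
    using assms fst[of u] fst[of v] by (intro rtrancl_edges_mult) auto
  then show "same_block (partition_mult n \<alpha> (partition_mult n \<beta> \<gamma>)) u v \<longleftrightarrow>
      (place 0 3 u, place 0 3 v) \<in> (edges 0 1 \<alpha> \<union> edges 1 2 \<beta> \<union> edges 2 3 \<gamma>)\<^sup>*"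
    using same_block_mult[OF assms(1) partition_on_mult, of 0 1 3] assms(4,5)
    by (simp add: Un_ac)
qed

lemma mult_assoc:
  assumes "partition_on (vertices n) \<alpha>" "partition_on (vertices n) \<beta>" "partition_on (vertices n) \<gamma>"
  shows "partition_mult n (partition_mult n \<alpha> \<beta>) \<gamma> = partition_mult n \<alpha> (partition_mult n \<beta> \<gamma>)"
  using same_block_mult3[OF assms] same_block_dom[OF partition_on_mult]
  by (intro partition_eqI[OF partition_on_mult partition_on_mult]) metis

lemma flip_flip [simp]: "flip_vertex (flip_vertex u) = u"
  by (cases u) auto

lemma flip_in_vertices [simp]: "flip_vertex u \<in> vertices n \<longleftrightarrow> u \<in> vertices n"
  by (cases u) auto

lemma place_flip: "place i j (flip_vertex u) = place j i u"
  by (cases u) auto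

lemma same_block_star: "same_block (star \<alpha>) u v \<longleftrightarrow> same_block \<alpha> (flip_vertex u) (flip_vertex v)"
  unfolding star_def same_block_rename by (metis flip_flip)

lemma star_star [simp]: "star (star \<alpha>) = \<alpha>"
  unfolding star_def rename_def by (simp add: image_image)

lemma edges_star: "edges i j (star \<alpha>) = edges j i \<alpha>"
proof -
  have "edges i j (star \<alpha>) \<subseteq> edges j i \<alpha>" for i j \<alpha>
  proof
    fix e assume "e \<in> edges i j (star \<alpha>)"
    then obtain u v where "same_block \<alpha> (flip_vertex u) (flip_vertex v)" "e = (place i j u, place i j v)"
      unfolding edges_def same_block_star by blast
    then show "e \<in> edges j i \<alpha>"
      using edgesI[of \<alpha> "flip_vertex u" "flip_vertex v" j i] by (simp add: place_flip)
  qed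
  from this[of i j \<alpha>] this[of j i "star \<alpha>"] show ?thesis by simp
qed

lemma partition_on_star:
  assumes "partition_on (vertices n) \<alpha>"
  shows "partition_on (vertices n) (star \<alpha>)"
proof -
  have "inj_on flip_vertex (vertices n)" by (metis flip_flip inj_onI)
  moreover have "flip_vertex ` vertices n = vertices n"
    by (metis flip_flip flip_in_vertices image_eqI image_subsetI subset_antisym subsetI)
  moreover have "(`) flip_vertex ` \<alpha> - {{}} = (`) flip_vertex ` \<alpha>"
    using partition_onD3[OF assms] by auto
  ultimately show ?thesis
    unfolding star_def rename_def using partition_on_inj_image[OF assms, of flip_vertex] by simp
qed

lemma star_mult:
  assumes "partition_on (vertices n) \<alpha>" "partition_on (vertices n) \<beta>"
  shows "star (partition_mult n \<alpha> \<beta>) = partition_mult n (star \<beta>) (star \<alpha>)"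
proof (rule partition_eqI[OF partition_on_star[OF partition_on_mult] partition_on_mult])
  fix u v
  show "same_block (star (partition_mult n \<alpha> \<beta>)) u v \<longleftrightarrow>
      same_block (partition_mult n (star \<beta>) (star \<alpha>)) u v"
  proof (cases "u \<in> vertices n \<and> v \<in> vertices n")
    case True
    then show ?thesis
      using same_block_mult[OF assms, of 0 1 2 "flip_vertex u" "flip_vertex v"]
        same_block_mult[OF partition_on_star partition_on_star, OF assms(2,1), of 2 1 0 u v]
      by (simp add: same_block_star edges_star place_flip Un_commute)
  next
    case False
    then show ?thesis
      using same_block_dom[OF partition_on_mult] by (metis flip_in_vertices same_block_star)
  qed
qed

definition fold_rows :: "nat set \<Rightarrow> nat \<times> nat \<Rightarrow> vertex" where
  "fold_rows U p = (if fst p \<in> U then Upper (snd p) else Lower (snd p))"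

lemma fold_rows_place:
  "u \<in> vertices n \<Longrightarrow> i \<in> U \<Longrightarrow> j \<notin> U \<Longrightarrow> fold_rows U (place i j u) = u"
  by (cases u) (auto simp: fold_rows_def)

lemma fold_rows_edges:
  assumes "partition_on (vertices n) \<alpha>" "i \<in> U" "j \<notin> U" "(p, q) \<in> edges i j \<alpha>"
  shows "same_block \<alpha> (fold_rows U p) (fold_rows U q)"
proof -
  obtain u v where "same_block \<alpha> u v" "p = place i j u" "q = place i j v"
    using assms(4) unfolding edges_def by blast
  then show ?thesis using fold_rows_place[OF _ assms(2,3)] same_block_dom[OF assms(1)] by metis
qed

lemma same_block_fold_path:
  assumes "partition_on (vertices n) \<alpha>" "(p, q) \<in> R\<^sup>*" "fold_rows U p \<in> vertices n"
    and "\<And>x y. (x, y) \<in> R \<Longrightarrow>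
      same_block \<alpha> (fold_rows U x) (fold_rows U y) \<or> fold_rows U x = fold_rows U y"
  shows "same_block \<alpha> (fold_rows U p) (fold_rows U q)"
  using assms(2)
proof induction
  case base
  show ?case using same_block_refl[OF assms(1,3)] .
next
  case (step y z)
  then show ?case using assms(4)[of y z] same_block_trans[OF assms(1)] by metis
qed

lemma sym_edges: "sym (edges i j \<alpha>)"
  using edges_sym by (rule symI)

lemma rtrancl_three: "(a, b) \<in> R \<Longrightarrow> (b, c) \<in> R \<Longrightarrow> (c, d) \<in> R \<Longrightarrow> (a, d) \<in> R\<^sup>*"
  by (rule rtrancl_into_rtrancl[OF rtrancl_into_rtrancl[OF r_into_rtrancl]])

lemma mult_star_mult:
  assumes "partition_on (vertices n) \<gamma>"
  shows "partition_mult n (partition_mult n \<gamma> (star \<gamma>)) \<gamma> = \<gamma>"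
proof (rule partition_eqI[OF partition_on_mult assms])
  fix u v
  let ?R = "edges 0 1 \<gamma> \<union> edges 2 1 \<gamma> \<union> edges 2 3 \<gamma>"
  show "same_block (partition_mult n (partition_mult n \<gamma> (star \<gamma>)) \<gamma>) u v \<longleftrightarrow> same_block \<gamma> u v"
  proof (cases "u \<in> vertices n \<and> v \<in> vertices n")
    case True
    have path: "(place 0 3 (Upper a), place 0 3 (Lower b)) \<in> ?R\<^sup>*" if "same_block \<gamma> (Upper a) (Lower b)" for a b
    proof -
      have "((0, a), (1, b)) \<in> ?R" "((1, b), (2, a)) \<in> ?R" "((2, a), (3, b)) \<in> ?R"
        using edgesI[OF that, of 0 1] edges_sym[OF edgesI[OF that, of 2 1]] edgesI[OF that, of 2 3] by auto
      then show ?thesis using rtrancl_three[of _ _ ?R] by simp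
    qed
    have "same_block \<gamma> u v" if "(place 0 3 u, place 0 3 v) \<in> ?R\<^sup>*"
    proof -
      have "same_block \<gamma> (fold_rows {0, 2} (place 0 3 u)) (fold_rows {0, 2} (place 0 3 v))"
        using True fold_rows_place[of u n 0 "{0, 2}" 3] fold_rows_edges[OF assms, of 0 "{0, 2}" 1]
          fold_rows_edges[OF assms, of 2 "{0, 2}" 1] fold_rows_edges[OF assms, of 2 "{0, 2}" 3]
        by (intro same_block_fold_path[OF assms that]) auto
      then show ?thesis using True by (simp add: fold_rows_place[where n = n])
    qed
    moreover have "(place 0 3 u, place 0 3 v) \<in> ?R\<^sup>*" if uv: "same_block \<gamma> u v"
    proof -
      have sym: "sym (?R\<^sup>*)" by (intro sym_rtrancl sym_Un sym_edges)
      consider a b where "u = Upper a" "v = Upper b" | a b where "u = Lower a" "v = Lower b"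
        | a b where "u = Upper a" "v = Lower b" | a b where "u = Lower a" "v = Upper b"
        using True by (auto elim!: vertex_cases)
      then show ?thesis
      proof cases
        case 1
        then show ?thesis using edgesI[OF uv, of 0 1] by auto
      next
        case 2
        then show ?thesis using edgesI[OF uv, of 2 3] by auto
      next
        case 3
        then show ?thesis using path uv by blast
      next
        case 4
        then show ?thesis using path same_block_sym[OF uv] symD[OF sym] by blast
      qed
    qed
    ultimately show ?thesis
      using same_block_mult3(1)[OF assms partition_on_star[OF assms] assms] True edges_star by metis
  next
    case False
    then show ?thesis using same_block_dom[OF partition_on_mult] same_block_dom[OF assms] by metis
  qed
qed

lemma same_block_one:
  "same_block (partition_one n) u v \<longleftrightarrow> (\<exists>x\<in>{1..n}. u \<in> {Upper x, Lower x} \<and> v \<in> {Upper x, Lower x})"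
  unfolding same_block_def partition_one_def by blast

lemma partition_on_one: "partition_on (vertices n) (partition_one n)"
proof -
  have "partition_one n = (\<lambda>x. {Upper x, Lower x}) ` {1..n}" unfolding partition_one_def by blast
  then show ?thesis by (intro partition_onI) (auto simp: vertices_def disjnt_def)
qed

lemma star_one: "star (partition_one n) = partition_one n"
proof (rule partition_eqI[OF partition_on_star[OF partition_on_one] partition_on_one])
  fix u v
  show "same_block (star (partition_one n)) u v \<longleftrightarrow> same_block (partition_one n) u v"
    unfolding same_block_star same_block_one by (cases u; cases v) auto
qed

lemma one_mult:
  assumes "partition_on (vertices n) \<alpha>"
  shows "partition_mult n (partition_one n) \<alpha> = \<alpha>"
proof (rule partition_eqI[OF partition_on_mult assms])
  fix u v
  let ?R = "edges 0 1 (partition_one n) \<union> edges 1 2 \<alpha>"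
  show "same_block (partition_mult n (partition_one n) \<alpha>) u v \<longleftrightarrow> same_block \<alpha> u v"
  proof (cases "u \<in> vertices n \<and> v \<in> vertices n")
    case True
    have fold1: "fold_rows {0, 1} x = fold_rows {0, 1} y" if "(x, y) \<in> edges 0 1 (partition_one n)" for x y
      using that unfolding edges_def same_block_one by (auto simp: fold_rows_def)
    have "same_block \<alpha> u v" if "(place 0 2 u, place 0 2 v) \<in> ?R\<^sup>*"
    proof -
      have "same_block \<alpha> (fold_rows {0, 1} (place 0 2 u)) (fold_rows {0, 1} (place 0 2 v))"
        using True fold_rows_place[of u n 0 "{0, 1}" 2] fold_rows_edges[OF assms, of 1 "{0, 1}" 2] fold1
        by (intro same_block_fold_path[OF assms that]) auto
      then show ?thesis using True by (simp add: fold_rows_place[where n = n])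
    qed
    moreover have "(place 0 2 u, place 0 2 v) \<in> ?R\<^sup>*" if uv: "same_block \<alpha> u v"
    proof -
      have sym: "sym (?R\<^sup>*)" by (intro sym_rtrancl sym_Un sym_edges)
      have *: "(place 0 2 w, place 1 2 w) \<in> ?R\<^sup>*" if "w \<in> vertices n" for w
        using that
      proof (cases rule: vertex_cases)
        case (Upper x)
        then have "same_block (partition_one n) (Upper x) (Lower x)" unfolding same_block_one by auto
        then show ?thesis using edgesI[of _ "Upper x" "Lower x" 0 1] Upper by auto
      qed auto
      have "(place 1 2 u, place 1 2 v) \<in> ?R" using edgesI[OF uv, of 1 2] by blast
      then show ?thesis using *[of u] *[of v] True symD[OF sym] by (meson rtrancl_into_rtrancl rtrancl_trans)
    qed
    ultimately show ?thesis using same_block_mult[OF partition_on_one assms, of 0 1 2] True by auto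
  next
    case False
    then show ?thesis using same_block_dom[OF partition_on_mult] same_block_dom[OF assms] by metis
  qed
qed

lemma mult_one:
  assumes "partition_on (vertices n) \<alpha>"
  shows "partition_mult n \<alpha> (partition_one n) = \<alpha>"
  using star_mult[OF partition_on_one partition_on_star[OF assms]] one_mult[OF partition_on_star[OF assms]]
  by (simp add: star_one)

section \<open>Kernels and ranks\<close>

lemma ker_subset_ker_mult:
  assumes "partition_on (vertices n) \<alpha>" "partition_on (vertices n) \<beta>"
  shows "ker \<alpha> \<subseteq> ker (partition_mult n \<alpha> \<beta>)"
proof (intro subrelI)
  fix x y assume "(x, y) \<in> ker \<alpha>"
  then have xy: "same_block \<alpha> (Upper x) (Upper y)" unfolding ker_def by simp
  then have "(place 0 2 (Upper x), place 0 2 (Upper y)) \<in> (edges 0 1 \<alpha> \<union> edges 1 2 \<beta>)\<^sup>*"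
    using edgesI[OF xy, of 0 1] by auto
  then show "(x, y) \<in> ker (partition_mult n \<alpha> \<beta>)"
    unfolding ker_def using same_block_mult[OF assms, of 0 1 2] same_block_dom[OF assms(1) xy] by simp
qed

lemma ker_mult_iff:
  assumes "partition_on (vertices n) \<alpha>" "partition_on (vertices n) \<beta>"
  shows "(x, y) \<in> ker (partition_mult n \<alpha> \<beta>) \<longleftrightarrow> x \<in> {1..n} \<and> y \<in> {1..n} \<and>
    ((0, x), (0, y)) \<in> ({((1, a), (1, b)) | a b. (a, b) \<in> ker \<beta>} \<union> edges 0 1 \<alpha>)\<^sup>*"
    (is "_ \<longleftrightarrow> _ \<and> _ \<and> ?p \<in> (?K \<union> _)\<^sup>*")
proof -
  let ?W = "{p. fst p \<noteq> (2::nat)} :: (nat \<times> nat) set"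
  have K: "?K \<subseteq> edges 1 2 \<beta>"
    using edgesI[where i = 1 and j = 2 and \<alpha> = \<beta>] unfolding ker_def by fastforce
  have "(edges 1 2 \<beta>)\<^sup>* \<inter> ?W \<times> ?W \<subseteq> ?K\<^sup>*"
  proof (intro subrelI)
    fix p q assume pq: "(p, q) \<in> (edges 1 2 \<beta>)\<^sup>* \<inter> ?W \<times> ?W"
    show "(p, q) \<in> ?K\<^sup>*"
    proof (cases "p = q")
      case False
      have "trans (edges 1 2 \<beta>)" using edges_trans[OF assms(2)] by (intro transI) auto
      then have "(p, q) \<in> edges 1 2 \<beta>"
        using pq False by (metis IntD1 rtranclD trancl_id)
      then obtain u v where uv: "same_block \<beta> u v" "p = place 1 2 u" "q = place 1 2 v"
        unfolding edges_def by blast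
      moreover have "u \<in> vertices n" "v \<in> vertices n" using same_block_dom[OF assms(2) uv(1)] .
      ultimately obtain a b where "u = Upper a" "v = Upper b" using pq by (auto elim!: vertex_cases)
      then show ?thesis using uv unfolding ker_def by auto
    qed simp
  qed
  moreover have "edges 0 1 \<alpha> \<subseteq> ?W \<times> ?W" using edges_subset[OF assms(1), of 0 1] by auto
  ultimately have "((0, x), (0, y)) \<in> (?K \<union> edges 0 1 \<alpha>)\<^sup>*"
    if "((0, x), (0, y)) \<in> (edges 1 2 \<beta> \<union> edges 0 1 \<alpha>)\<^sup>*"
    using rtrancl_hide[OF that, of ?W] by simp
  moreover have "(?K \<union> edges 0 1 \<alpha>)\<^sup>* \<subseteq> (edges 1 2 \<beta> \<union> edges 0 1 \<alpha>)\<^sup>*"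
    using K by (intro rtrancl_mono) blast
  ultimately have "((0, x), (0, y)) \<in> (?K \<union> edges 0 1 \<alpha>)\<^sup>* \<longleftrightarrow>
      ((0, x), (0, y)) \<in> (edges 0 1 \<alpha> \<union> edges 1 2 \<beta>)\<^sup>*"
    by (auto simp: Un_commute)
  moreover have "same_block (partition_mult n \<alpha> \<beta>) (Upper x) (Upper y) \<longleftrightarrow> x \<in> {1..n} \<and> y \<in> {1..n} \<and>
      ((0, x), (0, y)) \<in> (edges 0 1 \<alpha> \<union> edges 1 2 \<beta>)\<^sup>*"
  proof (cases "Upper x \<in> vertices n \<and> Upper y \<in> vertices n")
    case True
    then show ?thesis using same_block_mult[OF assms, of 0 1 2 "Upper x" "Upper y"] by simp
  next
    case False
    then show ?thesis using same_block_mult_iff[of n \<alpha> \<beta> "Upper x" "Upper y"] by auto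
  qed
  ultimately show ?thesis unfolding ker_def by simp
qed

lemma ker_mult_cong:
  assumes "partition_on (vertices n) \<alpha>" "partition_on (vertices n) \<beta>" "partition_on (vertices n) \<gamma>"
    and "ker \<beta> = ker \<gamma>"
  shows "ker (partition_mult n \<alpha> \<beta>) = ker (partition_mult n \<alpha> \<gamma>)"
proof -
  have "p \<in> ker (partition_mult n \<alpha> \<beta>) \<longleftrightarrow> p \<in> ker (partition_mult n \<alpha> \<gamma>)" for p
    using ker_mult_iff[OF assms(1,2)] ker_mult_iff[OF assms(1,3)] assms(4) by (cases p) simp
  then show ?thesis by blast
qed

lemma finite_vertices: "finite (vertices n)"
  unfolding vertices_def by simp

lemma finite_partition: "partition_on (vertices n) \<alpha> \<Longrightarrow> finite \<alpha>"
  using finite_elements[OF finite_vertices] .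

lemma rank_pos:
  assumes "partition_on (vertices n) \<alpha>" "same_block \<alpha> (Upper x) (Lower y)"
  shows "rank \<alpha> > 0"
  using assms finite_partition[OF assms(1)] unfolding rank_def same_block_def
  by (auto simp: card_gt_0_iff)

lemma rank_star:
  shows "rank (star \<alpha>) = rank \<alpha>"
proof -
  have eq: "{A \<in> star \<alpha>. (\<exists>x. Upper x \<in> A) \<and> (\<exists>y. Lower y \<in> A)} =
     (`) flip_vertex ` {A \<in> \<alpha>. (\<exists>x. Upper x \<in> A) \<and> (\<exists>y. Lower y \<in> A)}"
  proof -
    have "Upper x \<in> flip_vertex ` A \<longleftrightarrow> Lower x \<in> A" "Lower x \<in> flip_vertex ` A \<longleftrightarrow> Upper x \<in> A" for x A
      by (metis flip_flip flip_vertex.simps image_iff)+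
    moreover have "{A \<in> star \<alpha>. P A} = (`) flip_vertex ` {A \<in> \<alpha>. P (flip_vertex ` A)}" for P
      unfolding star_def rename_def by blast
    note this[of "\<lambda>A. (\<exists>x. Upper x \<in> A) \<and> (\<exists>y. Lower y \<in> A)"]
    ultimately show ?thesis by (simp only: conj_commute)
  qed
  have "inj ((`) flip_vertex)"
  proof (rule injI)
    fix A B assume "flip_vertex ` A = flip_vertex ` B"
    then have "flip_vertex ` flip_vertex ` A = flip_vertex ` flip_vertex ` B" by simp
    then show "A = B" by (simp add: image_image)
  qed
  then show ?thesis unfolding rank_def eq using card_image inj_on_subset subset_UNIV by blast
qed

lemma mult_transversal:
  assumes "partition_on (vertices n) \<alpha>" "partition_on (vertices n) \<beta>"
    and "same_block (partition_mult n \<alpha> \<beta>) (Upper a) (Lower b)"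
  obtains c where "same_block \<alpha> (Upper a) (Lower c)"
proof (rule ccontr)
  assume "\<not> thesis"
  then have no: "\<not> same_block \<alpha> (Upper a) (Lower c)" for c using that by blast
  have a: "a \<in> {1..n}" using same_block_dom[OF partition_on_mult assms(3)] by simp
  have "((0, a), (2, b)) \<in> (edges 0 1 \<alpha> \<union> edges 1 2 \<beta>)\<^sup>*"
    using same_block_mult[OF assms(1,2), of 0 1 2] same_block_dom[OF partition_on_mult assms(3)] assms(3)
    by simp
  moreover have "fst q = 0 \<and> same_block \<alpha> (Upper a) (Upper (snd q))"
    if "((0, a), q) \<in> (edges 0 1 \<alpha> \<union> edges 1 2 \<beta>)\<^sup>*" for q
    using that
  proof induction
    case base
    show ?case using same_block_refl[OF assms(1)] a by simp
  next
    case (step y z)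
    then obtain u v where uv: "same_block \<alpha> u v" "y = place 0 1 u" "z = place 0 1 v"
      using edges_subset[OF assms(2), of 1 2] unfolding edges_def by fastforce
    obtain x where u: "u = Upper x" "same_block \<alpha> (Upper a) (Upper x)"
      using uv step.IH same_block_dom(1)[OF assms(1) uv(1)] by (auto elim!: vertex_cases)
    then have "same_block \<alpha> (Upper a) v" using uv(1) same_block_trans[OF assms(1)] by blast
    then show ?case
      using no uv same_block_dom(2)[OF assms(1) uv(1)] by (auto elim!: vertex_cases)
  qed
  ultimately show False by fastforce
qed

text \<open>Every transversal block of the product contains the upper half of a transversal block of the
  first factor.\<close>

lemma rank_mult_le:
  assumes "partition_on (vertices n) \<alpha>" "partition_on (vertices n) \<beta>"
  shows "rank (partition_mult n \<alpha> \<beta>) \<le> rank \<alpha>"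
proof -
  let ?T = "\<lambda>\<gamma>. {A \<in> \<gamma>. (\<exists>x. Upper x \<in> A) \<and> (\<exists>y. Lower y \<in> A)}"
  let ?\<gamma> = "partition_mult n \<alpha> \<beta>"
  have uniq: "A = B" if "A \<in> ?\<gamma>" "B \<in> ?\<gamma>" "u \<in> A" "u \<in> B" for A B u
    using partition_on_mult[of n \<alpha> \<beta>] that unfolding partition_on_def disjoint_def by blast
  have "\<exists>B. B \<in> ?T \<alpha> \<and> (\<exists>x. Upper x \<in> A \<and> Upper x \<in> B)" if A: "A \<in> ?T ?\<gamma>" for A
  proof -
    obtain x y where xy: "Upper x \<in> A" "Lower y \<in> A" using A by blast
    then have "same_block ?\<gamma> (Upper x) (Lower y)" using A unfolding same_block_def by blast
    then obtain c where "same_block \<alpha> (Upper x) (Lower c)" using mult_transversal[OF assms] by blast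
    then show ?thesis using xy unfolding same_block_def by blast
  qed
  then have "\<forall>A\<in>?T ?\<gamma>. \<exists>B. B \<in> ?T \<alpha> \<and> (\<exists>x. Upper x \<in> A \<and> Upper x \<in> B)" by (rule ballI)
  from bchoice[OF this] obtain f
    where f: "\<forall>A\<in>?T ?\<gamma>. f A \<in> ?T \<alpha> \<and> (\<exists>x. Upper x \<in> A \<and> Upper x \<in> f A)" ..
  have "inj_on f (?T ?\<gamma>)"
  proof (rule inj_onI)
    fix A B assume AB: "A \<in> ?T ?\<gamma>" "B \<in> ?T ?\<gamma>" and eq: "f A = f B"
    obtain x y where x: "Upper x \<in> A" "Upper x \<in> f A" and y: "Upper y \<in> B" "Upper y \<in> f B"
      using bspec[OF f AB(1)] bspec[OF f AB(2)] by auto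
    then have "same_block \<alpha> (Upper x) (Upper y)" using bspec[OF f AB(1)] eq unfolding same_block_def by auto
    then have "(x, y) \<in> ker ?\<gamma>" using ker_subset_ker_mult[OF assms] unfolding ker_def by auto
    then obtain C where "C \<in> ?\<gamma>" "Upper x \<in> C" "Upper y \<in> C" unfolding ker_def same_block_def by auto
    then show "A = B" using uniq[of A C "Upper x"] uniq[of B C "Upper y"] AB x y by auto
  qed
  moreover have "f ` ?T ?\<gamma> \<subseteq> ?T \<alpha>" using f by blast
  moreover have "finite (?T \<alpha>)" using finite_partition[OF assms(1)] by simp
  ultimately show ?thesis unfolding rank_def by (rule card_inj_on_le)
qed

section \<open>Planarity of products\<close>

text \<open>Write the boundary of the first factor followed by that of the second one on a line, as
  positions 1, ..., 4n. The lower vertex 1' of the first factor and the upper vertex 1 of the second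
  one are then neighbours. Merging the blocks of two neighbours and deleting these two points
  creates no crossing, and makes the next pair 2', 2 neighbours.\<close>

definition noncrossing :: "nat set \<Rightarrow> (nat \<times> nat) set \<Rightarrow> bool" where
  "noncrossing W E \<longleftrightarrow> (\<forall>a\<in>W. \<forall>b\<in>W. \<forall>c\<in>W. \<forall>d\<in>W.
     a < b \<and> b < c \<and> c < d \<and> (a, c) \<in> E \<and> (b, d) \<in> E \<longrightarrow> (a, b) \<in> E)"

definition merge :: "nat \<Rightarrow> nat \<Rightarrow> (nat \<times> nat) set \<Rightarrow> (nat \<times> nat) set" where
  "merge p q E = E \<union> {(x, y). (x, p) \<in> E \<and> (q, y) \<in> E \<or> (x, q) \<in> E \<and> (p, y) \<in> E}"

lemma sym_merge:
  assumes "sym E"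
  shows "sym (merge p q E)"
  using assms unfolding merge_def by (intro symI) (auto dest: symD)

lemma trans_merge:
  assumes "sym E" "trans E"
  shows "trans (merge p q E)"
proof (rule transI)
  fix x y z assume "(x, y) \<in> merge p q E" "(y, z) \<in> merge p q E"
  then show "(x, z) \<in> merge p q E"
    using symD[OF assms(1)] transD[OF assms(2)] unfolding merge_def
    by (smt (verit) Un_iff case_prod_conv mem_Collect_eq)
qed

lemma noncrossing_merge:
  assumes "sym E" "trans E" and nc: "noncrossing W E" and pq: "p \<in> W" "q \<in> W" "p < q"
    and adj: "\<And>w. w \<in> W \<Longrightarrow> w \<le> p \<or> q \<le> w"
  shows "noncrossing (W - {p, q}) (merge p q E)"
  unfolding noncrossing_def
proof (intro ballI impI, elim conjE)
  fix a b c d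
  assume W: "a \<in> W - {p, q}" "b \<in> W - {p, q}" "c \<in> W - {p, q}" "d \<in> W - {p, q}"
    and less: "a < b" "b < c" "c < d" and ac: "(a, c) \<in> merge p q E" and bd: "(b, d) \<in> merge p q E"
  note sym = symD[OF \<open>sym E\<close>]
  have ncr: "(x, y) \<in> E" if "x < y" "y < z" "z < w" "(x, z) \<in> E" "(y, w) \<in> E"
    "x \<in> W" "y \<in> W" "z \<in> W" "w \<in> W" for x y z w
    using nc that unfolding noncrossing_def by blast
  have side: "w < p \<and> w < q \<or> p < w \<and> q < w" if "w \<in> W - {p, q}" for w
    using adj[of w] that pq(3) by auto
  have mI: "(x, y) \<in> merge p q E" if "(x, r) \<in> E" "(r', y) \<in> E" "r = p \<and> r' = q \<or> r = q \<and> r' = p" for x y r r'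
    using that unfolding merge_def by auto
  consider "(a, c) \<in> E" "(b, d) \<in> E"
    | r r' where "(a, c) \<in> E" "(b, r) \<in> E" "(r', d) \<in> E" "r = p \<and> r' = q \<or> r = q \<and> r' = p"
    | s s' where "(a, s) \<in> E" "(s', c) \<in> E" "(b, d) \<in> E" "s = p \<and> s' = q \<or> s = q \<and> s' = p"
    | s s' r r' where "(a, s) \<in> E" "(s', c) \<in> E" "(b, r) \<in> E" "(r', d) \<in> E"
      "s = p \<and> s' = q \<or> s = q \<and> s' = p" "r = p \<and> r' = q \<or> r = q \<and> r' = p"
    using ac bd unfolding merge_def by blast
  then show "(a, b) \<in> merge p q E"
  proof cases
    case 1
    then show ?thesis using ncr[OF less] W unfolding merge_def by blast
  next
    case 2
    have rW: "r \<in> W" "r' \<in> W" using 2(4) pq by auto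
    show ?thesis
    proof (cases "c < r \<and> c < r'")
      case True
      then show ?thesis using ncr[of a b c r] 2 less W rW unfolding merge_def by auto
    next
      case False
      then have "r' < c" using side[OF W(3)] 2(4) by auto
      show ?thesis
      proof (cases "a < r \<and> a < r'")
        case True
        then have "(a, r') \<in> E" using ncr[of a r' c d] \<open>r' < c\<close> 2 less W rW by auto
        then show ?thesis using mI[of a r' r b] 2(2,4) sym by blast
      next
        case False
        then have "r < a" using side[OF W(1)] 2(4) by auto
        then have "(r, a) \<in> E" using ncr[of r a b c] sym[OF 2(2)] 2 less W rW by auto
        then have "(a, b) \<in> E" using 2(2) sym transD[OF \<open>trans E\<close>] by blast
        then show ?thesis unfolding merge_def by blast
      qed
    qed
  next
    case 3
    have sW: "s \<in> W" "s' \<in> W" using 3(4) pq by auto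
    show ?thesis
    proof (cases "b < s \<and> b < s'")
      case True
      show ?thesis
      proof (cases "d < s \<and> d < s'")
        case False
        then have "s < d" using side[OF W(4)] 3(4) by auto
        then show ?thesis using ncr[of a b s d] True 3 less W sW unfolding merge_def by auto
      next
        case True
        then have "(b, c) \<in> E" using ncr[of b c d s'] sym[OF 3(2)] 3 less W sW by auto
        then have "(s', b) \<in> E" using 3(2) sym transD[OF \<open>trans E\<close>] by blast
        then show ?thesis using mI[of a s s' b] 3 by blast
      qed
    next
      case False
      then have "s' < b" using side[OF W(2)] 3(4) by auto
      then have "(s', b) \<in> E" using ncr[of s' b c d] 3 less W sW by auto
      then show ?thesis using mI[of a s s' b] 3 by blast
    qed
  next
    case 4
    then consider "s = r" | "s' = r" by blast
    then show ?thesis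
    proof cases
      case 1
      then have "(a, b) \<in> E" using 4(1,3) sym transD[OF \<open>trans E\<close>] by blast
      then show ?thesis unfolding merge_def by blast
    next
      case 2
      then show ?thesis using mI[of a s s' b] 4 sym by blast
    qed
  qed
qed

primrec glue :: "nat \<Rightarrow> (nat \<times> nat) set \<Rightarrow> nat \<Rightarrow> (nat \<times> nat) set" where
  "glue n E 0 = E"
| "glue n E (Suc k) = merge (2 * n - k) (2 * n + 1 + k) (glue n E k)"

lemma sym_trans_glue:
  assumes "sym E" "trans E"
  shows "sym (glue n E k) \<and> trans (glue n E k)"
  using assms by (induction k) (auto simp: sym_merge trans_merge)

lemma glue_mono: "k \<le> l \<Longrightarrow> glue n E k \<subseteq> glue n E l"
  by (induction rule: dec_induct) (auto simp: merge_def)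

lemma noncrossing_glue:
  assumes "sym E" "trans E" "noncrossing UNIV E" "k \<le> n"
  shows "noncrossing {x. x \<le> 2 * n - k \<or> 2 * n + k < x} (glue n E k)"
  using assms(4)
proof (induction k)
  case 0
  have "{x. x \<le> 2 * n - 0 \<or> 2 * n + 0 < x} = UNIV" by auto
  then show ?case using assms(3) by simp
next
  case (Suc k)
  let ?W = "{x. x \<le> 2 * n - k \<or> 2 * n + k < x}"
  have "noncrossing (?W - {2 * n - k, 2 * n + 1 + k}) (merge (2 * n - k) (2 * n + 1 + k) (glue n E k))"
    using Suc sym_trans_glue[OF assms(1,2)] by (intro noncrossing_merge) auto
  moreover have "?W - {2 * n - k, 2 * n + 1 + k} = {x. x \<le> 2 * n - Suc k \<or> 2 * n + Suc k < x}"
    using Suc.prems by auto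
  ultimately show ?case by simp
qed

lemma planar_iff:
  assumes "partition_on (vertices n) \<alpha>"
  shows "planar n \<alpha> \<longleftrightarrow> (\<forall>a b c d. same_block \<alpha> a c \<longrightarrow> same_block \<alpha> b d \<longrightarrow>
     boundary_pos n a < boundary_pos n b \<longrightarrow> boundary_pos n b < boundary_pos n c \<longrightarrow>
     boundary_pos n c < boundary_pos n d \<longrightarrow> same_block \<alpha> a b)" (is "_ \<longleftrightarrow> ?r")
proof -
  have block: "A = B" if "same_block \<alpha> a b" "a \<in> A" "A \<in> \<alpha>" "b \<in> B" "B \<in> \<alpha>" for a b A B
    using that(1) block_unique[OF assms] that(2-5) unfolding same_block_def by metis
  show ?thesis
  proof
    assume pl: "planar n \<alpha>"
    show ?r
    proof (intro allI impI)
      fix a b c d assume "same_block \<alpha> a c" "same_block \<alpha> b d"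
        and less: "boundary_pos n a < boundary_pos n b" "boundary_pos n b < boundary_pos n c"
        "boundary_pos n c < boundary_pos n d"
      then obtain A B where AB: "A \<in> \<alpha>" "B \<in> \<alpha>" "a \<in> A" "c \<in> A" "b \<in> B" "d \<in> B"
        unfolding same_block_def by blast
      have "A = B"
      proof (rule ccontr)
        assume "A \<noteq> B"
        have "\<not> planar n \<alpha>"
          unfolding planar_def not_not
          by (intro bexI[of _ A] bexI[of _ B] bexI[of _ a] bexI[of _ b] bexI[of _ c] bexI[of _ d]
              conjI less AB \<open>A \<noteq> B\<close>)
        then show False using pl by contradiction
      qed
      then show "same_block \<alpha> a b" using AB unfolding same_block_def by blast
    qed
  next
    assume ?r
    show "planar n \<alpha>"
      unfolding planar_def
    proof (intro notI, elim bexE conjE)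
      fix A B a b c d assume "A \<in> \<alpha>" "B \<in> \<alpha>" "A \<noteq> B" "a \<in> A" "b \<in> B" "c \<in> A" "d \<in> B"
        and less: "boundary_pos n a < boundary_pos n b" "boundary_pos n b < boundary_pos n c"
        "boundary_pos n c < boundary_pos n d"
      then have "same_block \<alpha> a c" "same_block \<alpha> b d" unfolding same_block_def by auto
      then have "same_block \<alpha> a b" using \<open>?r\<close> less by blast
      then show False using block \<open>A \<in> \<alpha>\<close> \<open>B \<in> \<alpha>\<close> \<open>A \<noteq> B\<close> \<open>a \<in> A\<close> \<open>b \<in> B\<close> by blast
    qed
  qed
qed

fun line_pos :: "nat \<Rightarrow> vertex \<Rightarrow> nat" where
  "line_pos n (Upper x) = x"
| "line_pos n (Middle x) = 2 * n + 1 - x"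
| "line_pos n (Lower x) = 4 * n + 1 - x"

definition line_vertex :: "nat \<Rightarrow> nat \<Rightarrow> vertex" where
  "line_vertex n x = (if x \<le> n then Upper x else if x \<le> 2 * n then Middle (2 * n + 1 - x)
     else if x \<le> 3 * n then Middle (x - 2 * n) else Lower (4 * n + 1 - x))"

definition juxtapose :: "nat \<Rightarrow> partition \<Rightarrow> partition \<Rightarrow> (nat \<times> nat) set" where
  "juxtapose n \<alpha> \<beta> = {(boundary_pos n u, boundary_pos n v) | u v. same_block \<alpha> u v} \<union>
     {(2 * n + boundary_pos n u, 2 * n + boundary_pos n v) | u v. same_block \<beta> u v}"

lemma boundary_pos_range: "u \<in> vertices n \<Longrightarrow> 1 \<le> boundary_pos n u \<and> boundary_pos n u \<le> 2 * n"
  by (cases u) auto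

lemma boundary_pos_inj:
  "u \<in> vertices n \<Longrightarrow> v \<in> vertices n \<Longrightarrow> boundary_pos n u = boundary_pos n v \<Longrightarrow> u = v"
  by (cases u; cases v) auto

lemma juxtapose_cases [consumes 3, case_names left right]:
  assumes "partition_on (vertices n) \<alpha>" "partition_on (vertices n) \<beta>" "(x, y) \<in> juxtapose n \<alpha> \<beta>"
  obtains u v where "same_block \<alpha> u v" "x = boundary_pos n u" "y = boundary_pos n v" "x \<le> 2 * n" "y \<le> 2 * n"
  | u v where "same_block \<beta> u v" "x = 2 * n + boundary_pos n u" "y = 2 * n + boundary_pos n v"
    "x > 2 * n" "y > 2 * n"
proof -
  consider u v where "same_block \<alpha> u v" "x = boundary_pos n u" "y = boundary_pos n v"
    | u v where "same_block \<beta> u v" "x = 2 * n + boundary_pos n u" "y = 2 * n + boundary_pos n v"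
    using assms(3) unfolding juxtapose_def by blast
  then show ?thesis
  proof cases
    case 1
    then show ?thesis
      using that(1) boundary_pos_range same_block_dom[OF assms(1) 1(1)] by metis
  next
    case 2
    moreover have "x > 2 * n" "y > 2 * n"
      using 2 boundary_pos_range[of u n] boundary_pos_range[of v n] same_block_dom[OF assms(2) 2(1)] by auto
    ultimately show ?thesis using that(2) by blast
  qed
qed

lemma sym_juxtapose: "sym (juxtapose n \<alpha> \<beta>)"
  unfolding juxtapose_def using same_block_sym by (intro symI) blast

lemma juxtapose_left:
  assumes "partition_on (vertices n) \<alpha>" "partition_on (vertices n) \<beta>" "u \<in> vertices n" "v \<in> vertices n"
  shows "(boundary_pos n u, boundary_pos n v) \<in> juxtapose n \<alpha> \<beta> \<longleftrightarrow> same_block \<alpha> u v"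
proof
  assume "(boundary_pos n u, boundary_pos n v) \<in> juxtapose n \<alpha> \<beta>"
  with assms(1,2) show "same_block \<alpha> u v"
  proof (cases rule: juxtapose_cases)
    case (left u' v')
    then have "u = u'" "v = v'"
      using boundary_pos_inj assms(3,4) same_block_dom[OF assms(1) left(1)] by auto
    then show ?thesis using left(1) by simp
  next
    case right
    then show ?thesis using boundary_pos_range[OF assms(3)] by auto
  qed
qed (auto simp: juxtapose_def)

lemma juxtapose_right:
  assumes "partition_on (vertices n) \<alpha>" "partition_on (vertices n) \<beta>" "u \<in> vertices n" "v \<in> vertices n"
  shows "(2 * n + boundary_pos n u, 2 * n + boundary_pos n v) \<in> juxtapose n \<alpha> \<beta> \<longleftrightarrow> same_block \<beta> u v"
proof
  assume "(2 * n + boundary_pos n u, 2 * n + boundary_pos n v) \<in> juxtapose n \<alpha> \<beta>"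
  with assms(1,2) show "same_block \<beta> u v"
  proof (cases rule: juxtapose_cases)
    case left
    then show ?thesis using boundary_pos_range[OF assms(3)] by auto
  next
    case (right u' v')
    then have "u = u'" "v = v'"
      using boundary_pos_inj assms(3,4) same_block_dom[OF assms(2) right(1)] by auto
    then show ?thesis using right(1) by simp
  qed
qed (auto simp: juxtapose_def)

lemma trans_juxtapose:
  assumes "partition_on (vertices n) \<alpha>" "partition_on (vertices n) \<beta>"
  shows "trans (juxtapose n \<alpha> \<beta>)"
proof (rule transI)
  fix x y z assume xy: "(x, y) \<in> juxtapose n \<alpha> \<beta>" and yz: "(y, z) \<in> juxtapose n \<alpha> \<beta>"
  show "(x, z) \<in> juxtapose n \<alpha> \<beta>"
    using assms xy
  proof (cases rule: juxtapose_cases)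
    case (left u v)
    from assms yz left(5) obtain v' w where vw: "same_block \<alpha> v' w" "y = boundary_pos n v'" "z = boundary_pos n w"
      by (cases rule: juxtapose_cases) auto
    then have "v = v'" using boundary_pos_inj left same_block_dom[OF assms(1)] by metis
    then have "same_block \<alpha> u w" using left(1) vw(1) same_block_trans[OF assms(1)] by blast
    then show ?thesis unfolding juxtapose_def using left(2) vw(3) by blast
  next
    case (right u v)
    from assms yz right(5) obtain v' w where vw: "same_block \<beta> v' w" "y = 2 * n + boundary_pos n v'" "z = 2 * n + boundary_pos n w"
      by (cases rule: juxtapose_cases) auto
    then have "v = v'" using boundary_pos_inj right same_block_dom[OF assms(2)] by (metis add_left_cancel)
    then have "same_block \<beta> u w" using right(1) vw(1) same_block_trans[OF assms(2)] by blast
    then show ?thesis unfolding juxtapose_def using right(2) vw(3) by blast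
  qed
qed

lemma noncrossing_juxtapose:
  assumes "partition_on (vertices n) \<alpha>" "partition_on (vertices n) \<beta>" "planar n \<alpha>" "planar n \<beta>"
  shows "noncrossing UNIV (juxtapose n \<alpha> \<beta>)"
  unfolding noncrossing_def
proof (intro ballI impI, elim conjE)
  fix a b c d assume less: "a < b" "b < c" "c < d"
    and ac: "(a, c) \<in> juxtapose n \<alpha> \<beta>" and bd: "(b, d) \<in> juxtapose n \<alpha> \<beta>"
  show "(a, b) \<in> juxtapose n \<alpha> \<beta>"
    using assms(1,2) ac
  proof (cases rule: juxtapose_cases)
    case (left u w)
    have "b \<le> 2 * n" using left(5) less by simp
    with assms(1,2) bd obtain v z where vz: "same_block \<alpha> v z" "b = boundary_pos n v" "d = boundary_pos n z"
      by (cases rule: juxtapose_cases) auto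
    then have "same_block \<alpha> u v" using left less assms(3) unfolding planar_iff[OF assms(1)] by blast
    then show ?thesis using left(2) vz(2) unfolding juxtapose_def by blast
  next
    case (right u w)
    have "b > 2 * n" using right(4) less by simp
    with assms(1,2) bd obtain v z where vz: "same_block \<beta> v z" "b = 2 * n + boundary_pos n v" "d = 2 * n + boundary_pos n z"
      by (cases rule: juxtapose_cases) auto
    moreover have "boundary_pos n u < boundary_pos n v" "boundary_pos n v < boundary_pos n w"
      "boundary_pos n w < boundary_pos n z"
      using less right vz by auto
    ultimately have "same_block \<beta> u v" using right(1) assms(4) unfolding planar_iff[OF assms(2)] by blast
    then show ?thesis using right(2) vz(2) unfolding juxtapose_def by blast
  qed
qed

lemma product_equivI:
  "same_block \<alpha> u v \<Longrightarrow> product_equiv \<alpha> \<beta> (lower_to_middle u) (lower_to_middle v)"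
  "same_block \<beta> u v \<Longrightarrow> product_equiv \<alpha> \<beta> (upper_to_middle u) (upper_to_middle v)"
  unfolding product_equiv_def by (rule r_into_equivclp, auto simp: same_block_Un same_block_rename)+

lemma glue_imp_product_equiv:
  assumes "partition_on (vertices n) \<alpha>" "partition_on (vertices n) \<beta>"
    and "k \<le> n" "(x, y) \<in> glue n (juxtapose n \<alpha> \<beta>) k"
  shows "product_equiv \<alpha> \<beta> (line_vertex n x) (line_vertex n y)"
  using assms(3,4)
proof (induction k arbitrary: x y)
  case 0
  have L: "line_vertex n (boundary_pos n u) = lower_to_middle u" if "u \<in> vertices n" for u
    using that unfolding line_vertex_def by (cases u) auto
  have R: "line_vertex n (2 * n + boundary_pos n u) = upper_to_middle u" if "u \<in> vertices n" for u
    using that unfolding line_vertex_def by (cases u) auto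
  from 0 have "(x, y) \<in> juxtapose n \<alpha> \<beta>" by simp
  with assms(1,2) show ?case
  proof (cases rule: juxtapose_cases)
    case (left u v)
    then show ?thesis using L same_block_dom[OF assms(1) left(1)] product_equivI(1) by simp
  next
    case (right u v)
    then show ?thesis using R same_block_dom[OF assms(2) right(1)] product_equivI(2) by simp
  qed
next
  case (Suc k)
  have "line_vertex n (2 * n - k) = line_vertex n (2 * n + 1 + k)"
    using Suc.prems(1) unfolding line_vertex_def by auto
  moreover have "(x, y) \<in> glue n (juxtapose n \<alpha> \<beta>) k \<or>
      (\<exists>r r'. (x, r) \<in> glue n (juxtapose n \<alpha> \<beta>) k \<and> (r', y) \<in> glue n (juxtapose n \<alpha> \<beta>) k \<and>
        {r, r'} = {2 * n - k, 2 * n + 1 + k})"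
    using Suc.prems(2) unfolding glue.simps merge_def by blast
  ultimately obtain r r' where "(x, y) \<in> glue n (juxtapose n \<alpha> \<beta>) k \<or>
      (x, r) \<in> glue n (juxtapose n \<alpha> \<beta>) k \<and> (r', y) \<in> glue n (juxtapose n \<alpha> \<beta>) k \<and>
      line_vertex n r = line_vertex n r'"
    by (metis doubleton_eq_iff)
  then show ?case
    using Suc.IH Suc.prems(1) equivclp_trans unfolding product_equiv_def by (metis Suc_leD)
qed

lemma product_equiv_imp_glue:
  assumes "partition_on (vertices n) \<alpha>" "partition_on (vertices n) \<beta>"
    and "u \<in> vertices n" "product_equiv \<alpha> \<beta> u v"
  shows "(line_pos n u, line_pos n v) \<in> glue n (juxtapose n \<alpha> \<beta>) n"
proof -
  let ?G = "glue n (juxtapose n \<alpha> \<beta>) n"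
  have G: "sym ?G" "trans ?G"
    using sym_trans_glue[OF sym_juxtapose trans_juxtapose[OF assms(1,2)]] by auto
  have J: "juxtapose n \<alpha> \<beta> \<subseteq> ?G" using glue_mono[of 0 n n "juxtapose n \<alpha> \<beta>"] by simp
  have glued: "(2 * n + 1 - x, 2 * n + x) \<in> ?G" if x: "x \<in> {1..n}" for x
  proof -
    have "(2 * n + 1 - x, 2 * n + 1 - x) \<in> juxtapose n \<alpha> \<beta>"
      using juxtapose_left[OF assms(1,2), of "Lower x" "Lower x"] same_block_refl[OF assms(1), of "Lower x"] x
      by simp
    moreover have "(2 * n + x, 2 * n + x) \<in> juxtapose n \<alpha> \<beta>"
      using juxtapose_right[OF assms(1,2), of "Upper x" "Upper x"] same_block_refl[OF assms(2), of "Upper x"] x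
      by simp
    ultimately have "(2 * n + 1 - x, 2 * n + x) \<in> merge (2 * n + 1 - x) (2 * n + x) (glue n (juxtapose n \<alpha> \<beta>) (x - 1))"
      using glue_mono[of 0 "x - 1" n "juxtapose n \<alpha> \<beta>"] unfolding merge_def by auto
    also have "\<dots> = glue n (juxtapose n \<alpha> \<beta>) x" using x by (cases x) auto
    also have "\<dots> \<subseteq> ?G" using x by (intro glue_mono) simp
    finally show ?thesis .
  qed
  have left: "(line_pos n (lower_to_middle y), line_pos n (lower_to_middle z)) \<in> ?G" if "same_block \<alpha> y z" for y z
  proof -
    have "line_pos n (lower_to_middle w) = boundary_pos n w" if "w \<in> vertices n" for w
      using that by (cases w) auto
    then show ?thesis
      using that same_block_dom[OF assms(1) that] J juxtapose_left[OF assms(1,2)] by auto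
  qed
  have right: "(line_pos n (upper_to_middle y), line_pos n (upper_to_middle z)) \<in> ?G" if "same_block \<beta> y z" for y z
  proof -
    have *: "(line_pos n (upper_to_middle w), 2 * n + boundary_pos n w) \<in> ?G" if w: "w \<in> vertices n" for w
      using w
    proof (cases rule: vertex_cases)
      case (Upper x)
      then show ?thesis using glued by simp
    next
      case (Lower x)
      then have "(2 * n + boundary_pos n w, 2 * n + boundary_pos n w) \<in> ?G"
        using J juxtapose_right[OF assms(1,2) w w] same_block_refl[OF assms(2) w] by blast
      moreover have "2 * n + boundary_pos n w = line_pos n (upper_to_middle w)" using Lower by auto
      ultimately show ?thesis by simp
    qed
    have "(2 * n + boundary_pos n y, 2 * n + boundary_pos n z) \<in> ?G"
      using that same_block_dom[OF assms(2) that] J juxtapose_right[OF assms(1,2)] by auto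
    then show ?thesis
      using *[of y] *[of z] same_block_dom[OF assms(2) that] symD[OF G(1)] transD[OF G(2)] by blast
  qed
  show ?thesis
    using assms(4) unfolding product_equiv_def
  proof (induction rule: equivclp_induct)
    case base
    have "line_pos n u = boundary_pos n u \<or> line_pos n u = 2 * n + boundary_pos n u"
      using assms(3) by (cases u) auto
    then show ?case
      using J juxtapose_left[OF assms(1,2,3,3)] juxtapose_right[OF assms(1,2,3,3)]
        same_block_refl[OF assms(1,3)] same_block_refl[OF assms(2,3)] by auto
  next
    case (step y z)
    then have "(line_pos n y, line_pos n z) \<in> ?G"
      using left right symD[OF G(1)] unfolding same_block_Un same_block_rename by blast
    with step.IH show ?case using transD[OF G(2)] by blast
  qed
qed

lemma planar_mult:
  assumes "partition_on (vertices n) \<alpha>" "partition_on (vertices n) \<beta>" "planar n \<alpha>" "planar n \<beta>"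
  shows "planar n (partition_mult n \<alpha> \<beta>)"
  unfolding planar_iff[OF partition_on_mult]
proof (intro allI impI)
  let ?G = "glue n (juxtapose n \<alpha> \<beta>) n"
  fix a b c d
  assume ac: "same_block (partition_mult n \<alpha> \<beta>) a c" and bd: "same_block (partition_mult n \<alpha> \<beta>) b d"
    and less: "boundary_pos n a < boundary_pos n b" "boundary_pos n b < boundary_pos n c"
      "boundary_pos n c < boundary_pos n d"
  have mem: "a \<in> vertices n" "b \<in> vertices n" "c \<in> vertices n" "d \<in> vertices n"
    using ac bd unfolding same_block_mult_iff by auto
  have mono: "line_pos n u < line_pos n v"
    if "boundary_pos n u < boundary_pos n v" "u \<in> vertices n" "v \<in> vertices n" for u v
    using that by (cases u; cases v) auto
  have range: "line_pos n u \<le> 2 * n - n \<or> 2 * n + n < line_pos n u" if "u \<in> vertices n" for u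
    using that by (cases u) auto
  have "noncrossing {x. x \<le> 2 * n - n \<or> 2 * n + n < x} ?G"
    using sym_juxtapose trans_juxtapose[OF assms(1,2)] noncrossing_juxtapose[OF assms]
    by (rule noncrossing_glue) simp
  moreover have "(line_pos n a, line_pos n c) \<in> ?G" "(line_pos n b, line_pos n d) \<in> ?G"
    using ac bd product_equiv_imp_glue[OF assms(1,2)] unfolding same_block_mult_iff by auto
  ultimately have "(line_pos n a, line_pos n b) \<in> ?G"
    unfolding noncrossing_def using mono less mem range by blast
  then have "product_equiv \<alpha> \<beta> (line_vertex n (line_pos n a)) (line_vertex n (line_pos n b))"
    by (rule glue_imp_product_equiv[OF assms(1,2), rotated]) simp
  moreover have "line_vertex n (line_pos n u) = u" if "u \<in> vertices n" for u
    using that unfolding line_vertex_def by (cases u) auto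
  ultimately show "same_block (partition_mult n \<alpha> \<beta>) a b"
    using mem unfolding same_block_mult_iff by simp
qed

section \<open>The action\<close>

lemma mult_M [simp]: "mult (M_monoid n) = partition_mult n"
  and one_M [simp]: "one (M_monoid n) = partition_one n"
  by (simp_all add: M_monoid_def planar_partition_monoid_def partition_monoid_def)

lemma carrier_M: "\<alpha> \<in> carrier (M_monoid n) \<longleftrightarrow>
    partition_on (vertices n) \<alpha> \<and> planar n \<alpha> \<and> same_block \<alpha> (Upper 1) (Lower 1)"
  by (simp add: M_monoid_def planar_partition_monoid_def partition_monoid_def)

lemma partition_on_M: "\<alpha> \<in> carrier (M_monoid n) \<Longrightarrow> partition_on (vertices n) \<alpha>"
  by (simp add: carrier_M)

lemma mult_in_M:
  assumes "\<alpha> \<in> carrier (M_monoid n)" "\<beta> \<in> carrier (M_monoid n)"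
  shows "partition_mult n \<alpha> \<beta> \<in> carrier (M_monoid n)"
proof -
  have ab: "partition_on (vertices n) \<alpha>" "partition_on (vertices n) \<beta>"
    "same_block \<alpha> (Upper 1) (Lower 1)" "same_block \<beta> (Upper 1) (Lower 1)"
    using assms by (auto simp: carrier_M)
  have "((0, 1), (1, 1)) \<in> edges 0 1 \<alpha>" "((1, 1), (2, 1)) \<in> edges 1 2 \<beta>"
    using edgesI[OF ab(3), of 0 1] edgesI[OF ab(4), of 1 2] by simp_all
  then have "((0, 1), (2, 1)) \<in> (edges 0 1 \<alpha> \<union> edges 1 2 \<beta>)\<^sup>*"
    by (meson UnCI r_into_rtrancl rtrancl_into_rtrancl)
  then have "same_block (partition_mult n \<alpha> \<beta>) (Upper 1) (Lower 1)"
    using same_block_mult[OF ab(1,2), of 0 1 2 "Upper 1" "Lower 1"] same_block_dom[OF ab(1,3)] by simp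
  then show ?thesis
    using assms planar_mult partition_on_mult unfolding carrier_M by blast
qed

lemma one_in_M:
  assumes "n \<ge> 1"
  shows "partition_one n \<in> carrier (M_monoid n)"
proof -
  have "planar n (partition_one n)"
    unfolding planar_iff[OF partition_on_one] same_block_one by auto
  then show ?thesis using assms partition_on_one unfolding carrier_M same_block_one by auto
qed

lemma monoid_M:
  assumes "n \<ge> 1"
  shows "monoid (M_monoid n)"
  by (rule monoidI) (simp_all add: mult_in_M one_in_M[OF assms] mult_assoc one_mult mult_one partition_on_M)

lemma boundary_pos_flip: "u \<in> vertices n \<Longrightarrow> boundary_pos n (flip_vertex u) = 2 * n + 1 - boundary_pos n u"
  by (cases u) auto

lemma planar_star:
  assumes "partition_on (vertices n) \<alpha>" "planar n \<alpha>"
  shows "planar n (star \<alpha>)"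
  unfolding planar_iff[OF partition_on_star[OF assms(1)]] same_block_star
proof (intro allI impI)
  fix a b c d
  assume ac: "same_block \<alpha> (flip_vertex a) (flip_vertex c)" and bd: "same_block \<alpha> (flip_vertex b) (flip_vertex d)"
    and less: "boundary_pos n a < boundary_pos n b" "boundary_pos n b < boundary_pos n c"
    "boundary_pos n c < boundary_pos n d"
  have mem: "a \<in> vertices n" "b \<in> vertices n" "c \<in> vertices n" "d \<in> vertices n"
    using same_block_dom[OF assms(1) ac] same_block_dom[OF assms(1) bd] by auto
  then have "boundary_pos n (flip_vertex d) < boundary_pos n (flip_vertex c)"
    "boundary_pos n (flip_vertex c) < boundary_pos n (flip_vertex b)"
    "boundary_pos n (flip_vertex b) < boundary_pos n (flip_vertex a)"
    using less boundary_pos_flip boundary_pos_range by (auto simp: less_diff_conv2 less_Suc_eq_le intro!: diff_less_mono2)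
  then have "same_block \<alpha> (flip_vertex d) (flip_vertex c)"
    using assms(2) same_block_sym[OF ac] same_block_sym[OF bd] unfolding planar_iff[OF assms(1)] by blast
  then show "same_block \<alpha> (flip_vertex a) (flip_vertex b)"
    using ac bd same_block_sym same_block_trans[OF assms(1)] by meson
qed

lemma star_in_M: "\<alpha> \<in> carrier (M_monoid n) \<Longrightarrow> star \<alpha> \<in> carrier (M_monoid n)"
  using planar_star partition_on_star same_block_sym unfolding carrier_M by (auto simp: same_block_star)

lemma Q_setD:
  assumes "\<epsilon> \<in> Q_set n"
  shows "\<epsilon> \<in> carrier (M_monoid n)" "partition_on (vertices n) \<epsilon>" "partition_mult n \<epsilon> \<epsilon> = \<epsilon>"
    "star \<epsilon> = \<epsilon>" "rank \<epsilon> \<in> {1, 2}"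
  using assms unfolding Q_set_def projections_def carrier_M by auto

lemma conj_eq_star_mult:
  assumes "\<epsilon> \<in> Q_set n" "partition_on (vertices n) \<alpha>"
  shows "partition_mult n (partition_mult n (star \<alpha>) \<epsilon>) \<alpha> =
    partition_mult n (star (partition_mult n \<epsilon> \<alpha>)) (partition_mult n \<epsilon> \<alpha>)"
  using assms Q_setD[OF assms(1)]
  by (simp add: star_mult mult_assoc partition_on_mult partition_on_star) (metis mult_assoc)

lemma conj_in_Q_set:
  assumes "\<epsilon> \<in> Q_set n" "\<alpha> \<in> carrier (M_monoid n)"
  shows "partition_mult n (partition_mult n (star \<alpha>) \<epsilon>) \<alpha> \<in> Q_set n"
proof -
  define \<gamma> where "\<gamma> = partition_mult n \<epsilon> \<alpha>"
  note \<epsilon> = Q_setD[OF assms(1)]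
  have \<gamma>: "\<gamma> \<in> carrier (M_monoid n)" unfolding \<gamma>_def using \<epsilon>(1) assms(2) by (rule mult_in_M)
  then have part: "partition_on (vertices n) \<gamma>" by (rule partition_on_M)
  note part' = partition_on_star[OF part]
  let ?\<delta> = "partition_mult n (star \<gamma>) \<gamma>"
  have M: "?\<delta> \<in> carrier (M_monoid n)" using \<gamma> by (intro mult_in_M star_in_M)
  moreover have "partition_mult n ?\<delta> ?\<delta> = ?\<delta>"
    using mult_assoc[OF part' part partition_on_mult, of "star \<gamma>" \<gamma>] mult_assoc[OF part part' part]
      mult_star_mult[OF part] by simp
  moreover have "star ?\<delta> = ?\<delta>" using star_mult[OF part' part] by simp
  moreover have "rank ?\<delta> \<le> 2"
  proof -
    have "rank ?\<delta> \<le> rank (star \<gamma>)" by (rule rank_mult_le[OF part' part])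
    also have "\<dots> = rank \<gamma>" by (rule rank_star)
    also have "\<dots> \<le> rank \<epsilon>" unfolding \<gamma>_def by (rule rank_mult_le[OF \<epsilon>(2) partition_on_M[OF assms(2)]])
    also have "\<dots> \<le> 2" using \<epsilon>(5) by auto
    finally show ?thesis .
  qed
  moreover have "rank ?\<delta> > 0" using M rank_pos unfolding carrier_M by blast
  ultimately have "?\<delta> \<in> Q_set n" unfolding Q_set_def projections_def by auto
  then show ?thesis
    using conj_eq_star_mult[OF assms(1) partition_on_M[OF assms(2)]] unfolding \<gamma>_def by simp
qed

lemma mu_None [simp]: "mu n None \<alpha> = None"
  by (simp add: mu_def)

lemma mu_Some:
  assumes "\<epsilon> \<in> Q_set n"
  shows "mu n (Some \<epsilon>) \<alpha> = (if ker \<epsilon> = ker (partition_mult n \<epsilon> \<alpha>)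
    then Some (partition_mult n (partition_mult n (star \<alpha>) \<epsilon>) \<alpha>) else None)"
  using assms by (simp add: mu_def)

lemma right_action_mu: "right_action (M_monoid n) (Q_minus n) (mu n)"
  unfolding right_action_def
proof (intro conjI funcsetI ballI)
  fix x \<alpha> assume "x \<in> Q_minus n" "\<alpha> \<in> carrier (M_monoid n)"
  then show "mu n x \<alpha> \<in> Q_minus n"
    using mu_Some conj_in_Q_set unfolding Q_minus_def by auto
next
  fix x \<alpha> \<beta> assume x: "x \<in> Q_minus n" and \<alpha>M: "\<alpha> \<in> carrier (M_monoid n)" and \<beta>M: "\<beta> \<in> carrier (M_monoid n)"
  show "mu n (mu n x \<alpha>) \<beta> = mu n x (\<alpha> \<otimes>\<^bsub>M_monoid n\<^esub> \<beta>)"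
  proof (cases x)
    case (Some \<epsilon>)
    then have \<epsilon>: "\<epsilon> \<in> Q_set n" using x unfolding Q_minus_def by auto
    note \<alpha> = partition_on_M[OF \<alpha>M] and \<beta> = partition_on_M[OF \<beta>M] and pm = partition_on_mult
    define \<gamma> where "\<gamma> = partition_mult n \<epsilon> \<alpha>"
    define \<delta> where "\<delta> = partition_mult n (partition_mult n (star \<alpha>) \<epsilon>) \<alpha>"
    have \<gamma>: "partition_on (vertices n) \<gamma>" unfolding \<gamma>_def by (rule pm)
    have \<delta>: "\<delta> = partition_mult n (star \<gamma>) \<gamma>"
      unfolding \<delta>_def \<gamma>_def by (rule conj_eq_star_mult[OF \<epsilon> \<alpha>])
    have \<delta>Q: "\<delta> \<in> Q_set n" unfolding \<delta>_def by (rule conj_in_Q_set[OF \<epsilon> \<alpha>M])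
    have \<gamma>\<beta>: "partition_mult n \<epsilon> (partition_mult n \<alpha> \<beta>) = partition_mult n \<gamma> \<beta>"
      unfolding \<gamma>_def using mult_assoc[OF Q_setD(2)[OF \<epsilon>] \<alpha> \<beta>] by simp
    have \<gamma>\<delta>: "partition_mult n \<gamma> \<delta> = \<gamma>"
      unfolding \<delta> using mult_assoc[OF \<gamma> partition_on_star[OF \<gamma>] \<gamma>] mult_star_mult[OF \<gamma>] by simp
    have \<gamma>\<delta>\<beta>: "partition_mult n \<gamma> (partition_mult n \<delta> \<beta>) = partition_mult n \<gamma> \<beta>"
      using mult_assoc[OF \<gamma> Q_setD(2)[OF \<delta>Q] \<beta>] \<gamma>\<delta> by simp
    have \<delta>\<beta>: "partition_mult n \<delta> \<beta> = partition_mult n (star \<gamma>) (partition_mult n \<gamma> \<beta>)"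
      unfolding \<delta> by (rule mult_assoc[OF partition_on_star[OF \<gamma>] \<gamma> \<beta>])
    have iff: "ker \<epsilon> = ker (partition_mult n \<gamma> \<beta>) \<longleftrightarrow>
        ker \<epsilon> = ker \<gamma> \<and> ker \<delta> = ker (partition_mult n \<delta> \<beta>)"
    proof
      assume eq: "ker \<epsilon> = ker (partition_mult n \<gamma> \<beta>)"
      then have "ker \<epsilon> = ker \<gamma>"
        using ker_subset_ker_mult[OF Q_setD(2)[OF \<epsilon>] \<alpha>] ker_subset_ker_mult[OF \<gamma> \<beta>]
        unfolding \<gamma>_def by blast
      moreover from this have "ker \<delta> = ker (partition_mult n \<delta> \<beta>)"
        unfolding \<delta>\<beta> using eq ker_mult_cong[OF partition_on_star[OF \<gamma>] \<gamma> pm] \<delta> by simp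
      ultimately show "ker \<epsilon> = ker \<gamma> \<and> ker \<delta> = ker (partition_mult n \<delta> \<beta>)" ..
    next
      assume "ker \<epsilon> = ker \<gamma> \<and> ker \<delta> = ker (partition_mult n \<delta> \<beta>)"
      then show "ker \<epsilon> = ker (partition_mult n \<gamma> \<beta>)"
        using ker_mult_cong[OF \<gamma> Q_setD(2)[OF \<delta>Q] pm, of \<delta> \<beta>] \<gamma>\<delta> \<gamma>\<delta>\<beta> by simp
    qed
    have "partition_mult n (partition_mult n (star \<beta>) \<delta>) \<beta> =
        partition_mult n (partition_mult n (star (partition_mult n \<alpha> \<beta>)) \<epsilon>) (partition_mult n \<alpha> \<beta>)"
      unfolding \<delta>_def using \<alpha> \<beta> Q_setD(2)[OF \<epsilon>]
      by (simp add: star_mult mult_assoc pm partition_on_star)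
    then show ?thesis
      unfolding Some mult_M mu_Some[OF \<epsilon>] \<gamma>\<beta> iff \<gamma>_def[symmetric] \<delta>_def[symmetric]
      using mu_Some[OF \<delta>Q] by simp
  qed simp
qed

section \<open>Faithfulness\<close>

definition fibres :: "nat \<Rightarrow> (vertex \<Rightarrow> 'a) \<Rightarrow> partition" where
  "fibres n f = vertices n // {(u, v). u \<in> vertices n \<and> v \<in> vertices n \<and> f u = f v}"

lemma equiv_fibres: "equiv (vertices n) {(u, v). u \<in> vertices n \<and> v \<in> vertices n \<and> f u = f v}"
  by (auto intro!: equivI refl_onI symI transI)

lemma partition_on_fibres: "partition_on (vertices n) (fibres n f)"
  unfolding fibres_def by (rule partition_on_quotient[OF equiv_fibres])

lemma same_block_fibres: "same_block (fibres n f) u v \<longleftrightarrow> u \<in> vertices n \<and> v \<in> vertices n \<and> f u = f v"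
  unfolding fibres_def same_block_quotient[OF equiv_fibres] by simp

lemma rtrancl_label:
  assumes "(p, q) \<in> R\<^sup>*" "\<And>x y. (x, y) \<in> R \<Longrightarrow> f x = f y"
  shows "f p = f q"
  using assms(1) by induction (use assms(2) in auto)

text \<open>The projection with blocks \<open>{1, i, 1', i'}\<close>, \<open>{j, j'}\<close> and singletons, where each vertex is
  labelled by a member of its block. For \<open>j > n\<close> the second block is absent.\<close>

fun two_label :: "nat \<Rightarrow> nat \<Rightarrow> vertex \<Rightarrow> vertex" where
  "two_label i j (Upper x) = (if x = 1 \<or> x = i then Upper 1 else Upper x)"
| "two_label i j (Lower x) = (if x = 1 \<or> x = i then Upper 1 else if x = j then Upper j else Lower x)"
| "two_label i j (Middle x) = Middle x"

definition two_proj :: "nat \<Rightarrow> nat \<Rightarrow> nat \<Rightarrow> partition" where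
  "two_proj n i j = fibres n (two_label i j)"

lemma partition_on_two_proj: "partition_on (vertices n) (two_proj n i j)"
  unfolding two_proj_def by (rule partition_on_fibres)

lemma same_block_two_proj: "same_block (two_proj n i j) u v \<longleftrightarrow>
    u \<in> vertices n \<and> v \<in> vertices n \<and> two_label i j u = two_label i j v"
  unfolding two_proj_def same_block_fibres ..

lemma star_two_proj:
  assumes "1 \<le> i" "i < j"
  shows "star (two_proj n i j) = two_proj n i j"
proof (rule partition_eqI[OF partition_on_star[OF partition_on_two_proj] partition_on_two_proj])
  fix u v
  show "same_block (star (two_proj n i j)) u v \<longleftrightarrow> same_block (two_proj n i j) u v"
    unfolding same_block_star same_block_two_proj using assms by (cases u; cases v) auto
qed

lemma planar_two_proj:
  assumes "1 \<le> i" "i < j"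
  shows "planar n (two_proj n i j)"
  unfolding planar_iff[OF partition_on_two_proj]
proof (intro allI impI)
  fix a b c d
  assume ac: "same_block (two_proj n i j) a c" and bd: "same_block (two_proj n i j) b d"
    and less: "boundary_pos n a < boundary_pos n b" "boundary_pos n b < boundary_pos n c"
      "boundary_pos n c < boundary_pos n d"
  have two: "two_label i j u = Upper 1 \<and> two_label i j v = Upper 1 \<or> u = Upper j \<and> v = Lower j"
    if "same_block (two_proj n i j) u v" "boundary_pos n u < boundary_pos n v" for u v
    using that unfolding same_block_two_proj by (cases u; cases v) (auto split: if_splits)
  have outer: "boundary_pos n u \<le> i \<or> 2 * n + 1 - i \<le> boundary_pos n u"
    if "u \<in> vertices n" "two_label i j u = Upper 1" for u
    using that assms by (cases u) (auto split: if_splits)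
  have mem: "a \<in> vertices n" "b \<in> vertices n" "c \<in> vertices n" "d \<in> vertices n"
    using ac bd unfolding same_block_two_proj by auto
  have "two_label i j a = two_label i j b"
    using two[OF ac less_trans[OF less(1,2)]] two[OF bd less_trans[OF less(2,3)]]
  proof (elim disjE conjE)
    assume "two_label i j a = Upper 1" "two_label i j c = Upper 1" "b = Upper j" "d = Lower j"
    then have False using less outer[of c] mem assms by auto
    then show ?thesis ..
  next
    assume "two_label i j b = Upper 1" "two_label i j d = Upper 1" "a = Upper j" "c = Lower j"
    then have False using less outer[of b] mem assms by auto
    then show ?thesis ..
  qed auto
  then show "same_block (two_proj n i j) a b" using mem unfolding same_block_two_proj by blast
qed

lemma two_proj_idem:
  assumes "1 \<le> i" "i < j"
  shows "partition_mult n (two_proj n i j) (two_proj n i j) = two_proj n i j"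
proof (rule partition_eqI[OF partition_on_mult partition_on_two_proj])
  fix u v
  let ?e = "two_proj n i j"
  let ?R = "edges 0 1 ?e \<union> edges 1 2 ?e"
  define f :: "nat \<times> nat \<Rightarrow> vertex" where "f = (\<lambda>(l, x). if x = 1 \<or> x = i then Upper 1
    else if x = j then Upper j else if l = 0 then Upper x else if l = 1 then Middle x else Lower x)"
  have f: "f p = f q" if "(p, q) \<in> ?R" for p q
  proof -
    from that obtain y z where "same_block ?e y z"
      "p = place 0 1 y \<and> q = place 0 1 z \<or> p = place 1 2 y \<and> q = place 1 2 z"
      unfolding edges_def by blast
    then show ?thesis
      unfolding same_block_two_proj f_def using assms by (cases y; cases z) (auto split: if_splits)
  qed
  show "same_block (partition_mult n ?e ?e) u v \<longleftrightarrow> same_block ?e u v"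
  proof (cases "u \<in> vertices n \<and> v \<in> vertices n")
    case True
    have "same_block ?e u v" if "(place 0 2 u, place 0 2 v) \<in> ?R\<^sup>*"
    proof -
      have "f (place 0 2 w) = two_label i j w" if "w \<in> vertices n" for w
        using that unfolding f_def by (cases w) auto
      then have "two_label i j u = two_label i j v" using rtrancl_label[of _ _ ?R f, OF that f] True by simp
      then show ?thesis using True unfolding same_block_two_proj by blast
    qed
    moreover have "(place 0 2 u, place 0 2 v) \<in> ?R\<^sup>*" if uv: "same_block ?e u v"
    proof -
      have sym: "sym (?R\<^sup>*)" by (intro sym_rtrancl sym_Un sym_edges)
      have path: "((0, a), (2, b)) \<in> ?R\<^sup>*" if ab: "same_block ?e (Upper a) (Lower b)" for a b
      proof -
        have "same_block ?e (Upper b) (Lower b)"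
          using ab unfolding same_block_two_proj by (auto split: if_splits)
        then have "((0, a), (1, b)) \<in> ?R" "((1, b), (2, b)) \<in> ?R"
          using edgesI[OF ab, of 0 1] edgesI[of ?e "Upper b" "Lower b" 1 2] by auto
        then show ?thesis by (rule rtrancl_into_rtrancl[OF r_into_rtrancl])
      qed
      consider a b where "u = Upper a" "v = Upper b" | a b where "u = Lower a" "v = Lower b"
        | a b where "u = Upper a" "v = Lower b" | a b where "u = Lower a" "v = Upper b"
        using True by (auto elim!: vertex_cases)
      then show ?thesis
      proof cases
        case 1
        then show ?thesis using edgesI[OF uv, of 0 1] by auto
      next
        case 2
        then show ?thesis using edgesI[OF uv, of 1 2] by auto
      next
        case 3
        then show ?thesis using path uv by simp
      next
        case 4
        then have "((0, b), (2, a)) \<in> ?R\<^sup>*" using path same_block_sym[OF uv] by blast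
        then show ?thesis using 4 symD[OF sym] by simp
      qed
    qed
    ultimately show ?thesis
      using same_block_mult[OF partition_on_two_proj partition_on_two_proj, of 0 1 2 u n v i j i j] True by auto
  next
    case False
    then show ?thesis unfolding same_block_mult_iff same_block_two_proj by blast
  qed
qed

lemma two_proj_in_Q_set:
  assumes "1 \<le> i" "i < j" "1 \<le> n"
  shows "two_proj n i j \<in> Q_set n"
proof -
  let ?e = "two_proj n i j"
  let ?T = "{A \<in> ?e. (\<exists>x. Upper x \<in> A) \<and> (\<exists>y. Lower y \<in> A)}"
  have one: "same_block ?e (Upper 1) (Lower 1)" unfolding same_block_two_proj using assms(3) by simp
  have "?T \<subseteq> (\<lambda>c. {u \<in> vertices n. two_label i j u = c}) ` {Upper 1, Upper j}"
  proof
    fix A assume "A \<in> ?T"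
    then obtain x y where A: "A \<in> ?e" "Upper x \<in> A" "Lower y \<in> A" by blast
    then have "same_block ?e (Upper x) (Lower y)" unfolding same_block_def by blast
    then have "two_label i j (Upper x) \<in> {Upper 1, Upper j}"
      unfolding same_block_two_proj by (auto split: if_splits)
    moreover have "A = {u \<in> vertices n. two_label i j u = two_label i j (Upper x)}"
    proof -
      have "u \<in> A \<longleftrightarrow> same_block ?e u (Upper x)" for u
        using A block_unique[OF partition_on_two_proj] unfolding same_block_def by metis
      then show ?thesis
        using same_block_dom[OF partition_on_two_proj \<open>same_block ?e (Upper x) (Lower y)\<close>]
        unfolding same_block_two_proj by blast
    qed
    ultimately show "A \<in> (\<lambda>c. {u \<in> vertices n. two_label i j u = c}) ` {Upper 1, Upper j}" by blast
  qed
  then have "rank ?e \<le> card {Upper 1, Upper j}" unfolding rank_def by (rule surj_card_le[rotated]) simp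
  also have "\<dots> \<le> 2" by (simp add: card_insert_if)
  finally have "rank ?e \<le> 2" .
  moreover have "rank ?e > 0" using rank_pos[OF partition_on_two_proj one] .
  ultimately have "rank ?e \<in> {1, 2}" by auto
  then show ?thesis
    using two_proj_idem star_two_proj planar_two_proj partition_on_two_proj one assms
    unfolding Q_set_def projections_def by (simp add: carrier_M)
qed

lemma ker_two_proj_mult:
  assumes "partition_on (vertices n) \<alpha>" "1 \<le> i" "i \<le> n" "i < j"
  shows "ker (two_proj n i j) = ker (partition_mult n (two_proj n i j) \<alpha>) \<longleftrightarrow>
    (1, j) \<notin> ker \<alpha> \<and> (i, j) \<notin> ker \<alpha>" (is "?l \<longleftrightarrow> ?r")
proof
  let ?e = "two_proj n i j"
  let ?R = "edges 0 1 ?e \<union> edges 1 2 \<alpha>"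
  note mult = same_block_mult[OF partition_on_two_proj assms(1), of 0 1 2]
  assume l: ?l
  have "(k, j) \<notin> ker \<alpha>" if k: "k = 1 \<or> k = i" for k
  proof
    assume "(k, j) \<in> ker \<alpha>"
    then have kj: "same_block \<alpha> (Upper k) (Upper j)" unfolding ker_def by simp
    then have mem: "k \<in> {1..n}" "j \<in> {1..n}" using same_block_dom[OF assms(1) kj] by auto
    have "same_block ?e (Upper k) (Lower k)" "same_block ?e (Lower j) (Upper j)"
      unfolding same_block_two_proj using mem k assms by auto
    then have "((0, k), (1, k)) \<in> ?R" "((1, j), (0, j)) \<in> ?R" "((1, k), (1, j)) \<in> ?R"
      using edgesI[of ?e "Upper k" "Lower k" 0 1] edgesI[of ?e "Lower j" "Upper j" 0 1]
        edgesI[OF kj, of 1 2] by auto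
    then have "((0, k), (0, j)) \<in> ?R\<^sup>*" using rtrancl_three[of _ _ ?R] by blast
    then have "(k, j) \<in> ker ?e" using l mult[of "Upper k" "Upper j"] mem unfolding ker_def by simp
    then show False unfolding ker_def same_block_two_proj using k assms by (auto split: if_splits)
  qed
  then show ?r by blast
next
  let ?e = "two_proj n i j"
  let ?R = "edges 0 1 ?e \<union> edges 1 2 \<alpha>"
  assume r: ?r
  define g where "g = (\<lambda>v. if same_block \<alpha> v (Upper 1) \<or> same_block \<alpha> v (Upper i) then Upper 1
    else if same_block \<alpha> v (Upper j) then Upper j else Middle 0)"
  define f where "f = (\<lambda>p. if fst p = 0 then two_label i j (Upper (snd p)) else g (fold_rows {1} p))"
  have g: "g u = g v" if "same_block \<alpha> u v" for u v
    using that same_block_sym same_block_trans[OF assms(1)] unfolding g_def by (smt (verit))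
  have g1: "g (Upper x) = Upper 1" if "x = 1 \<or> x = i" for x
    using that same_block_refl[OF assms(1)] assms unfolding g_def by auto
  have gj: "g (Upper j) = Upper j" if "j \<in> {1..n}"
    using r same_block_refl[OF assms(1), of "Upper j"] same_block_sym that unfolding g_def ker_def by auto
  have "f p = f q" if pq: "(p, q) \<in> ?R" for p q
  proof -
    consider "(p, q) \<in> edges 1 2 \<alpha>" | u v where "same_block ?e u v" "p = place 0 1 u" "q = place 0 1 v"
      using pq unfolding edges_def[of 0] by blast
    then show ?thesis
    proof cases
      case 1
      then have "fst p \<noteq> 0" "fst q \<noteq> 0" using edges_subset[OF assms(1), of 1 2] by auto
      then show ?thesis using g fold_rows_edges[OF assms(1), of 1 "{1}" 2, OF _ _ 1] unfolding f_def by simp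
    next
      case 2
      then show ?thesis
        unfolding same_block_two_proj f_def fold_rows_def using g1 gj
        by (cases u; cases v) (auto split: if_splits)
    qed
  qed
  then have label: "f p = f q" if "(p, q) \<in> ?R\<^sup>*" for p q using rtrancl_label[OF that] by blast
  have "ker (partition_mult n ?e \<alpha>) \<subseteq> ker ?e"
  proof (intro subrelI)
    fix x y assume "(x, y) \<in> ker (partition_mult n ?e \<alpha>)"
    then have xy: "same_block (partition_mult n ?e \<alpha>) (Upper x) (Upper y)" unfolding ker_def by simp
    note mem = same_block_dom[OF partition_on_mult xy]
    then have "((0, x), (0, y)) \<in> ?R\<^sup>*"
      using xy same_block_mult[OF partition_on_two_proj assms(1), of 0 1 2] by simp
    then have "two_label i j (Upper x) = two_label i j (Upper y)" using label unfolding f_def by fastforce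
    then show "(x, y) \<in> ker ?e" using mem unfolding ker_def same_block_two_proj by simp
  qed
  then show ?l using ker_subset_ker_mult[OF partition_on_two_proj assms(1)] by blast
qed

lemma same_block_conj_two_proj:
  assumes "partition_on (vertices n) \<alpha>" "1 < j" "a \<in> {1..n}" "b \<in> {1..n}"
  defines "\<delta> \<equiv> partition_mult n (partition_mult n (star \<alpha>) (two_proj n 1 j)) \<alpha>"
  shows "same_block \<delta> (Lower a) (Lower b) \<longleftrightarrow> same_block \<alpha> (Lower a) (Lower b)"
    and "same_block \<delta> (Upper a) (Lower a) \<longleftrightarrow>
      same_block \<alpha> (Upper 1) (Lower a) \<or> same_block \<alpha> (Upper j) (Lower a)"
proof -
  let ?e = "two_proj n 1 j"
  let ?R = "edges 1 0 \<alpha> \<union> edges 1 2 ?e \<union> edges 2 3 \<alpha>"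
  have mult: "same_block \<delta> u v \<longleftrightarrow> (place 0 3 u, place 0 3 v) \<in> ?R\<^sup>*"
    if "u \<in> vertices n" "v \<in> vertices n" for u v
    unfolding \<delta>_def
    using same_block_mult3(1)[OF partition_on_star[OF assms(1)] partition_on_two_proj assms(1)] that
    by (simp add: edges_star)
  have e: "snd p = snd q \<and> fst p \<in> {1, 2} \<and> fst q \<in> {1, 2} \<and> (fst p \<noteq> fst q \<longrightarrow> snd p = 1 \<or> snd p = j)"
    if "(p, q) \<in> edges 1 2 ?e" for p q
  proof -
    from that obtain u v where "same_block ?e u v" "p = place 1 2 u" "q = place 1 2 v"
      unfolding edges_def by blast
    then show ?thesis
      unfolding same_block_two_proj by (cases u; cases v) (auto split: if_splits)
  qed
  let ?f = "fold_rows {1, 2}"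
  have fold: "same_block \<alpha> (?f p) (?f q) \<or> ?f p = ?f q" if "(p, q) \<in> ?R" for p q
    using that e[of p q] fold_rows_edges[OF assms(1), of 1 "{1, 2}" 0 p q]
      fold_rows_edges[OF assms(1), of 2 "{1, 2}" 3 p q] by (auto simp: fold_rows_def)
  have path_fold: "same_block \<alpha> (?f p) (?f q)" if "(p, q) \<in> ?R\<^sup>*" "?f p \<in> vertices n" for p q
    using assms(1) that fold by (rule same_block_fold_path)
  show "same_block \<delta> (Lower a) (Lower b) \<longleftrightarrow> same_block \<alpha> (Lower a) (Lower b)"
  proof
    assume "same_block \<delta> (Lower a) (Lower b)"
    then have "((3, a), (3, b)) \<in> ?R\<^sup>*" using mult assms(3,4) by simp
    from path_fold[OF this] show "same_block \<alpha> (Lower a) (Lower b)" using assms(3) by (simp add: fold_rows_def)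
  next
    assume ab: "same_block \<alpha> (Lower a) (Lower b)"
    have "((3, a), (3, b)) \<in> ?R\<^sup>*" using edgesI[OF ab, of 2 3] by auto
    then show "same_block \<delta> (Lower a) (Lower b)" using mult assms(3,4) by simp
  qed
  show "same_block \<delta> (Upper a) (Lower a) \<longleftrightarrow>
      same_block \<alpha> (Upper 1) (Lower a) \<or> same_block \<alpha> (Upper j) (Lower a)"
  proof
    assume "same_block \<delta> (Upper a) (Lower a)"
    then have path: "((0, a), (3, a)) \<in> ?R\<^sup>*" using mult assms(3) by simp
    show "same_block \<alpha> (Upper 1) (Lower a) \<or> same_block \<alpha> (Upper j) (Lower a)"
    proof (rule ccontr)
      assume no: "\<not> ?thesis"
      have "fst q \<in> {0, 1}" if "((0, a), q) \<in> ?R\<^sup>*" for q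
        using that
      proof induction
        case (step y z)
        have a: "same_block \<alpha> (Lower a) (?f y)"
          using path_fold[OF step.hyps(1)] assms(3) by (simp add: fold_rows_def)
        consider "(y, z) \<in> edges 1 0 \<alpha>" | "(y, z) \<in> edges 1 2 ?e" | "(y, z) \<in> edges 2 3 \<alpha>"
          using step.hyps(2) by blast
        then show ?case
        proof cases
          case 1
          then show ?thesis using edges_subset[OF assms(1), of 1 0] by auto
        next
          case 2
          have "fst y = fst z"
          proof (rule ccontr)
            assume "fst y \<noteq> fst z"
            then have "?f y = Upper 1 \<or> ?f y = Upper j" using e[OF 2] by (auto simp: fold_rows_def)
            then show False using a no same_block_sym by metis
          qed
          then show ?thesis using step.IH by simp
        next
          case 3
          then show ?thesis using step.IH edges_subset[OF assms(1), of 2 3] by auto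
        qed
      qed simp
      from this[OF path] show False by simp
    qed
  next
    assume "same_block \<alpha> (Upper 1) (Lower a) \<or> same_block \<alpha> (Upper j) (Lower a)"
    then obtain k where k: "k = 1 \<or> k = j" "same_block \<alpha> (Upper k) (Lower a)" by blast
    have "same_block ?e (Upper k) (Lower k)"
      using k(1) same_block_dom[OF assms(1) k(2)] unfolding same_block_two_proj by auto
    then have "((0, a), (1, k)) \<in> ?R" "((1, k), (2, k)) \<in> ?R" "((2, k), (3, a)) \<in> ?R"
      using edgesI[OF same_block_sym[OF k(2)], of 1 0] edgesI[of ?e "Upper k" "Lower k" 1 2]
        edgesI[OF k(2), of 2 3] by auto
    then have "((0, a), (3, a)) \<in> ?R\<^sup>*" by (rule rtrancl_three)
    then show "same_block \<delta> (Upper a) (Lower a)" using mult assms(3) by simp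
  qed
qed

lemma ker_sym: "(x, y) \<in> ker \<alpha> \<longleftrightarrow> (y, x) \<in> ker \<alpha>"
  unfolding ker_def using same_block_sym by auto

lemma ker_trans:
  assumes "partition_on A \<alpha>" "(x, y) \<in> ker \<alpha>" "(y, z) \<in> ker \<alpha>"
  shows "(x, z) \<in> ker \<alpha>"
  using assms same_block_trans[OF assms(1)] unfolding ker_def by blast

lemma faithful_mu: "faithful (M_monoid n) (Q_minus n) (mu n)"
  unfolding faithful_def
proof (rule inj_onI)
  fix \<alpha> \<beta>
  assume \<alpha>M: "\<alpha> \<in> carrier (M_monoid n)" and \<beta>M: "\<beta> \<in> carrier (M_monoid n)"
    and eq: "(\<lambda>x\<in>Q_minus n. mu n x \<alpha>) = (\<lambda>x\<in>Q_minus n. mu n x \<beta>)"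
  note \<alpha> = partition_on_M[OF \<alpha>M] and \<beta> = partition_on_M[OF \<beta>M]
  have one: "same_block \<alpha> (Upper 1) (Lower 1)" "same_block \<beta> (Upper 1) (Lower 1)"
    using \<alpha>M \<beta>M by (auto simp: carrier_M)
  have n: "1 \<le> n" using same_block_dom(1)[OF \<alpha> one(1)] by simp
  have mu_eq: "mu n (Some (two_proj n i j)) \<alpha> = mu n (Some (two_proj n i j)) \<beta>" if "1 \<le> i" "i < j" for i j
    using fun_cong[OF eq, of "Some (two_proj n i j)"] two_proj_in_Q_set[OF that n] unfolding Q_minus_def by simp
  let ?\<delta> = "\<lambda>\<gamma> j. partition_mult n (partition_mult n (star \<gamma>) (two_proj n 1 j)) \<gamma>"
  have mu_iff: "mu n (Some (two_proj n i j)) \<gamma> =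
      (if (1, j) \<notin> ker \<gamma> \<and> (i, j) \<notin> ker \<gamma>
       then Some (partition_mult n (partition_mult n (star \<gamma>) (two_proj n i j)) \<gamma>) else None)"
    if "partition_on (vertices n) \<gamma>" "1 \<le> i" "i < j" "i \<le> n" for i j \<gamma>
    using mu_Some[OF two_proj_in_Q_set[OF that(2,3) n]] ker_two_proj_mult[OF that(1,2,4,3)] by simp
  have ker_dom: "(x, y) \<in> ker \<gamma> \<Longrightarrow> x \<in> {1..n} \<and> y \<in> {1..n}" if "partition_on (vertices n) \<gamma>" for x y \<gamma>
    using same_block_dom[OF that] unfolding ker_def by fastforce
  have coker: "same_block \<alpha> (Lower a) (Lower b) \<longleftrightarrow> same_block \<beta> (Lower a) (Lower b)"
    if "a \<in> {1..n}" "b \<in> {1..n}" for a b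
  proof -
    have "(1, n + 1) \<notin> ker \<alpha>" "(1, n + 1) \<notin> ker \<beta>" using ker_dom[OF \<alpha>] ker_dom[OF \<beta>] by fastforce+
    then have "?\<delta> \<alpha> (n + 1) = ?\<delta> \<beta> (n + 1)"
      using mu_eq[of 1 "n + 1"] mu_iff[OF \<alpha>, of 1 "n + 1"] mu_iff[OF \<beta>, of 1 "n + 1"] n by simp
    then show ?thesis
      using same_block_conj_two_proj(1)[OF \<alpha>, of "n + 1" a b]
        same_block_conj_two_proj(1)[OF \<beta>, of "n + 1" a b] n that by simp
  qed
  have meet: "(1, j) \<in> ker \<alpha> \<or> (i, j) \<in> ker \<alpha> \<longleftrightarrow> (1, j) \<in> ker \<beta> \<or> (i, j) \<in> ker \<beta>"
    if "1 \<le> i" "i < j" "i \<le> n" for i j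
    using mu_eq[OF that(1,2)] mu_iff[OF \<alpha> that] mu_iff[OF \<beta> that] by (auto split: if_splits)
  have ker1: "(1, j) \<in> ker \<alpha> \<longleftrightarrow> (1, j) \<in> ker \<beta>" for j
  proof (cases "1 < j")
    case True
    then show ?thesis using meet[of 1 j] n by simp
  next
    case False
    then have "j = 0 \<or> j = 1" by auto
    then show ?thesis
      using ker_dom[OF \<alpha>, of 1 j] ker_dom[OF \<beta>, of 1 j] same_block_refl[OF \<alpha>, of "Upper 1"]
        same_block_refl[OF \<beta>, of "Upper 1"] n unfolding ker_def by auto
  qed
  have ker_less: "(i, j) \<in> ker \<alpha> \<longleftrightarrow> (i, j) \<in> ker \<beta>" if "1 \<le> i" "i < j" "i \<le> n" for i j
  proof (cases "(1, j) \<in> ker \<alpha>")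
    case True
    have "(i, j) \<in> ker \<gamma> \<longleftrightarrow> (1, i) \<in> ker \<gamma>" if "partition_on (vertices n) \<gamma>" "(1, j) \<in> ker \<gamma>" for \<gamma>
      using ker_trans[OF that(1)] ker_sym that(2) by metis
    from this[OF \<alpha>] this[OF \<beta>] show ?thesis using True ker1 by blast
  next
    case False
    then show ?thesis using meet[OF that] ker1 by blast
  qed
  have ker: "(i, j) \<in> ker \<alpha> \<longleftrightarrow> (i, j) \<in> ker \<beta>" if "i \<in> {1..n}" "j \<in> {1..n}" for i j
  proof -
    consider "i < j" | "j < i" | "i = j" by linarith
    then show ?thesis
    proof cases
      case 1
      then show ?thesis using ker_less that by simp
    next
      case 2
      then have "(j, i) \<in> ker \<alpha> \<longleftrightarrow> (j, i) \<in> ker \<beta>" using ker_less that by simp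
      then show ?thesis by (subst (1 2) ker_sym)
    next
      case 3
      then show ?thesis
        using that same_block_refl[OF \<alpha>, of "Upper i"] same_block_refl[OF \<beta>, of "Upper i"]
        unfolding ker_def by simp
    qed
  qed
  have link1: "same_block \<alpha> (Upper 1) (Lower b) \<longleftrightarrow> same_block \<beta> (Upper 1) (Lower b)" if "b \<in> {1..n}" for b
  proof -
    have "same_block \<gamma> (Upper 1) (Lower b) \<longleftrightarrow> same_block \<gamma> (Lower 1) (Lower b)"
      if "partition_on (vertices n) \<gamma>" "same_block \<gamma> (Upper 1) (Lower 1)" for \<gamma>
      using same_block_trans[OF that(1)] same_block_sym that(2) by metis
    from this[OF \<alpha> one(1)] this[OF \<beta> one(2)] show ?thesis using coker[of 1 b] n that by simp
  qed
  have link: "same_block \<alpha> (Upper j) (Lower b) \<longleftrightarrow> same_block \<beta> (Upper j) (Lower b)"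
    if j: "j \<in> {1..n}" and b: "b \<in> {1..n}" for j b
  proof (cases "(1, j) \<in> ker \<alpha>")
    case True
    have "same_block \<gamma> (Upper j) (Lower b) \<longleftrightarrow> same_block \<gamma> (Upper 1) (Lower b)"
      if "partition_on (vertices n) \<gamma>" "(1, j) \<in> ker \<gamma>" for \<gamma>
      using same_block_trans[OF that(1)] same_block_sym that(2) unfolding ker_def by blast
    from this[OF \<alpha>] this[OF \<beta>] show ?thesis using True ker1 link1[OF b] by blast
  next
    case False
    have "(1, 1) \<in> ker \<alpha>" using same_block_refl[OF \<alpha>, of "Upper 1"] n unfolding ker_def by simp
    then have "j \<noteq> 1" using False by auto
    then have "1 < j" using j by auto
    have "(1, j) \<notin> ker \<beta>" using False ker1 by blast
    then have \<delta>: "?\<delta> \<alpha> j = ?\<delta> \<beta> j"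
      using mu_eq[of 1 j] mu_iff[OF \<alpha>, of 1 j] mu_iff[OF \<beta>, of 1 j] n \<open>1 < j\<close> False by simp
    have "same_block \<gamma> (Upper j) (Lower b) \<longleftrightarrow>
        same_block (?\<delta> \<gamma> j) (Upper b) (Lower b) \<and> \<not> same_block \<gamma> (Upper 1) (Lower b)"
      if "partition_on (vertices n) \<gamma>" "(1, j) \<notin> ker \<gamma>" for \<gamma>
      using same_block_conj_two_proj(2)[OF that(1) \<open>1 < j\<close> b b] that(2)
        same_block_trans[OF that(1)] same_block_sym unfolding ker_def by blast
    from this[OF \<alpha> False] this[OF \<beta> \<open>(1, j) \<notin> ker \<beta>\<close>] show ?thesis using \<delta> link1[OF b] by simp
  qed
  show "\<alpha> = \<beta>"
    using ker coker link unfolding ker_def by (intro partition_eqI_rows[OF \<alpha> \<beta>]) auto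
qed

section \<open>A generator\<close>

lemma projection_diagonal:
  assumes "partition_on (vertices n) \<delta>" "partition_mult n \<delta> \<delta> = \<delta>" "star \<delta> = \<delta>"
    and ab: "same_block \<delta> (Upper a) (Lower b)"
  shows "same_block \<delta> (Upper a) (Lower a)"
proof -
  have ba: "same_block \<delta> (Upper b) (Lower a)"
    using same_block_star[of \<delta> "Upper b" "Lower a"] same_block_sym[OF ab] assms(3) by simp
  have "((0, a), (1, b)) \<in> edges 0 1 \<delta>" "((1, b), (2, a)) \<in> edges 1 2 \<delta>"
    using edgesI[OF ab, of 0 1] edgesI[OF ba, of 1 2] by simp_all
  then have "((0, a), (2, a)) \<in> (edges 0 1 \<delta> \<union> edges 1 2 \<delta>)\<^sup>*"
    by (meson UnCI r_into_rtrancl rtrancl_into_rtrancl)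
  then show ?thesis
    using same_block_mult[OF assms(1,1), of 0 1 2 "Upper a" "Lower a"] assms(2)
      same_block_dom[OF assms(1) ab] same_block_dom[OF assms(1) ba] by simp
qed

lemma projection_eqI:
  assumes \<delta>: "partition_on (vertices n) \<delta>" "partition_mult n \<delta> \<delta> = \<delta>" "star \<delta> = \<delta>"
    and \<epsilon>: "partition_on (vertices n) \<epsilon>" "partition_mult n \<epsilon> \<epsilon> = \<epsilon>" "star \<epsilon> = \<epsilon>"
    and lower: "\<And>a b. a \<in> {1..n} \<Longrightarrow> b \<in> {1..n} \<Longrightarrow>
      same_block \<delta> (Lower a) (Lower b) \<longleftrightarrow> same_block \<epsilon> (Lower a) (Lower b)"
    and diag: "\<And>a. a \<in> {1..n} \<Longrightarrow> same_block \<delta> (Upper a) (Lower a) \<longleftrightarrow> same_block \<epsilon> (Upper a) (Lower a)"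
  shows "\<delta> = \<epsilon>"
proof -
  have link: "same_block \<gamma> (Upper a) (Lower b) \<longleftrightarrow>
      same_block \<gamma> (Upper a) (Lower a) \<and> same_block \<gamma> (Lower a) (Lower b)"
    if "partition_on (vertices n) \<gamma>" "partition_mult n \<gamma> \<gamma> = \<gamma>" "star \<gamma> = \<gamma>" for \<gamma> a b
    using projection_diagonal[OF that] same_block_trans[OF that(1)] same_block_sym by meson
  show ?thesis
  proof (rule partition_eqI_rows[OF \<delta>(1) \<epsilon>(1) _ lower])
    fix a b assume ab: "a \<in> {1..n}" "b \<in> {1..n}"
    show "same_block \<delta> (Upper a) (Upper b) \<longleftrightarrow> same_block \<epsilon> (Upper a) (Upper b)"
      using lower[OF ab] same_block_star[of \<delta> "Upper a" "Upper b"] same_block_star[of \<epsilon> "Upper a" "Upper b"]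
        \<delta>(3) \<epsilon>(3) by simp
    show "same_block \<delta> (Upper a) (Lower b) \<longleftrightarrow> same_block \<epsilon> (Upper a) (Lower b)"
      using link[OF \<delta>] link[OF \<epsilon>] lower[OF ab] diag[OF ab(1)] by metis
  qed
qed

text \<open>\<open>\<alpha>\<close> has the lower blocks of \<open>\<delta>\<close>; the upper vertices 1 and 2 are joined to the transversal
  blocks of \<open>\<delta>\<close>, and the remaining upper vertices are singletons. If \<open>\<delta>\<close> has rank 1, the upper
  vertex 2 is a singleton as well (its label \<open>A2\<close> is then the empty set).\<close>

lemma ex_conj_two_proj_eq:
  assumes "n \<ge> 2" and \<delta>Q: "\<delta> \<in> Q_set n"
  obtains \<alpha> where "\<alpha> \<in> carrier (M_monoid n)" "(1, 2) \<notin> ker \<alpha>"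
    "partition_mult n (partition_mult n (star \<alpha>) (two_proj n 1 2)) \<alpha> = \<delta>"
proof -
  note \<delta> = Q_setD(2)[OF \<delta>Q] and proj = Q_setD(2-4)[OF \<delta>Q]
  define blk where "blk = (\<lambda>u. {v. same_block \<delta> u v})"
  have blk_self: "u \<in> blk u" if "u \<in> vertices n" for u
    using same_block_refl[OF \<delta> that] unfolding blk_def by simp
  have blk_eq: "blk u = blk v \<longleftrightarrow> same_block \<delta> u v" if "u \<in> vertices n" "v \<in> vertices n" for u v
    using same_block_trans[OF \<delta>] same_block_sym blk_self[OF that(2)] unfolding blk_def by blast
  have block_blk: "A = blk u" if "A \<in> \<delta>" "u \<in> A" for A u
    using that block_unique[OF \<delta>] unfolding blk_def same_block_def by blast
  define T where "T = {A \<in> \<delta>. (\<exists>x. Upper x \<in> A) \<and> (\<exists>y. Lower y \<in> A)}"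
  define A1 where "A1 = blk (Lower 1)"
  have finT: "finite T" unfolding T_def using finite_partition[OF \<delta>] by simp
  have card: "card T \<le> 2" using Q_setD(5)[OF \<delta>Q] unfolding rank_def T_def by auto
  have one: "same_block \<delta> (Upper 1) (Lower 1)" using Q_setD(1)[OF \<delta>Q] unfolding carrier_M by simp
  have diag_T: "blk (Lower a) \<in> T \<longleftrightarrow> same_block \<delta> (Upper a) (Lower a)" for a
  proof
    assume "blk (Lower a) \<in> T"
    then obtain x where "same_block \<delta> (Lower a) (Upper x)" unfolding T_def blk_def by blast
    then have "same_block \<delta> (Upper a) (Lower x)" using same_block_star[of \<delta> "Upper a" "Lower x"] proj(3) by simp
    then show "same_block \<delta> (Upper a) (Lower a)" by (rule projection_diagonal[OF proj])
  next
    assume a: "same_block \<delta> (Upper a) (Lower a)"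
    then obtain A where "A \<in> \<delta>" "Upper a \<in> A" "Lower a \<in> A" unfolding same_block_def by blast
    then show "blk (Lower a) \<in> T" using block_blk[of A "Lower a"] unfolding T_def by auto
  qed
  have A1: "A1 \<in> T" unfolding A1_def diag_T by (rule one)
  obtain A2 where A2: "A2 \<noteq> A1" "A2 = {} \<or> A2 \<in> T" "T \<subseteq> {A1, A2}"
  proof (cases "T \<subseteq> {A1}")
    case True
    have "A1 \<noteq> {}" using A1 unfolding T_def by blast
    then show ?thesis using that[of "{}"] True by blast
  next
    case False
    then obtain B where B: "B \<in> T" "B \<noteq> A1" by blast
    then have "{A1, B} = T" using finT A1 card by (intro card_seteq) auto
    then show ?thesis using that[of B] B by blast
  qed
  define f where "f = rec_vertex (\<lambda>x. if x = 1 then A1 else if x = 2 then A2 else {Upper x})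
    (\<lambda>_. {}) (\<lambda>y. blk (Lower y))"
  have f_simps: "f (Upper x) = (if x = 1 then A1 else if x = 2 then A2 else {Upper x})"
    "f (Lower y) = blk (Lower y)" for x y
    unfolding f_def by simp_all
  define \<alpha> where "\<alpha> = fibres n f"
  have \<alpha>: "partition_on (vertices n) \<alpha>" unfolding \<alpha>_def by (rule partition_on_fibres)
  have sb: "same_block \<alpha> u v \<longleftrightarrow> u \<in> vertices n \<and> v \<in> vertices n \<and> f u = f v" for u v
    unfolding \<alpha>_def same_block_fibres ..
  have not_single: "A1 \<noteq> {Upper x}" "A2 \<noteq> {Upper x}" for x
    using A1 A2(2) unfolding T_def by auto
  have upper_inj: "x = y" if "f (Upper x) = f (Upper y)" for x y
    using that not_single A2(1) not_single[symmetric] unfolding f_simps by (auto split: if_splits)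
  have upper_lower: "(x = 1 \<or> x = 2) \<and> blk (Lower p) \<in> T"
    if "f (Upper x) = f (Lower p)" "Lower p \<in> vertices n" for x p
    using that blk_self[OF that(2)] A1 A2(2) unfolding f_simps by (auto split: if_splits)
  have "planar n \<alpha>"
    unfolding planar_iff[OF \<alpha>]
  proof (intro allI impI)
    fix a b c d
    assume ac: "same_block \<alpha> a c" and bd: "same_block \<alpha> b d"
      and less: "boundary_pos n a < boundary_pos n b" "boundary_pos n b < boundary_pos n c"
        "boundary_pos n c < boundary_pos n d"
    have mem: "a \<in> vertices n" "b \<in> vertices n" "c \<in> vertices n" "d \<in> vertices n"
      using same_block_dom[OF \<alpha> ac] same_block_dom[OF \<alpha> bd] by auto
    have fac: "f a = f c" and fbd: "f b = f d" using ac bd unfolding sb by auto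
    have planar: "same_block \<delta> a b" if "same_block \<delta> a c" "same_block \<delta> b d"
      "boundary_pos n a < boundary_pos n b" "boundary_pos n b < boundary_pos n c"
      "boundary_pos n c < boundary_pos n d" for a b c d
      using Q_setD(1)[OF \<delta>Q] that unfolding carrier_M planar_iff[OF \<delta>] by blast
    obtain p where c: "c = Lower p" "p \<in> {1..n}"
      using mem(3)
    proof (cases rule: vertex_cases)
      case (Upper x)
      then obtain y where a: "a = Upper y" using less mem(1) by (cases a) auto
      then have "y = x" using fac Upper by (intro upper_inj) simp
      then show ?thesis using less a Upper by simp
    qed
    then obtain q where d: "d = Lower q" "q \<in> {1..n}" "q < p"
      using less mem(4) by (cases d) auto
    have "f a = f b"
      using mem(1)
    proof (cases rule: vertex_cases)
      case (Lower x)
      then obtain y where b: "b = Lower y" using less mem(2) by (cases b) auto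
      then have "same_block \<delta> a c" "same_block \<delta> b d"
        using fac fbd mem blk_eq Lower c d by (auto simp: f_simps)
      then have "same_block \<delta> a b" using planar less by blast
      then show ?thesis using blk_eq mem Lower b by (simp add: f_simps)
    next
      case (Upper x)
      then have x: "x = 1 \<or> x = 2" "blk (Lower p) \<in> T" using upper_lower fac c mem(3) by auto
      show ?thesis
        using mem(2)
      proof (cases rule: vertex_cases)
        case b: (Upper y)
        then have y: "y = 1 \<or> y = 2" "blk (Lower q) \<in> T" using upper_lower fbd d mem(4) by auto
        then have "x = 1" "y = 2" using x(1) less Upper b by auto
        then have pA: "blk (Lower p) = A1" and qA: "blk (Lower q) = A2"
          using fac fbd Upper b c d by (auto simp: f_simps)
        have "same_block \<delta> (Lower p) (Lower 1)"
          using pA blk_eq[of "Lower p" "Lower 1"] c(2) assms(1) unfolding A1_def by simp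
        then have "same_block \<delta> (Upper 1) (Upper p)"
          using same_block_star[of \<delta> "Upper 1" "Upper p"] proj(3) same_block_sym by simp
        moreover have "same_block \<delta> (Upper q) (Lower q)" using y(2) diag_T by blast
        moreover have "q \<noteq> 1" using qA A2(1) unfolding A1_def by auto
        ultimately have "same_block \<delta> (Upper 1) (Upper q)"
          using planar[of "Upper 1" "Upper p" "Upper q" "Lower q"] c d by simp
        then have "same_block \<delta> (Lower 1) (Lower q)"
          using same_block_star[of \<delta> "Upper 1" "Upper q"] proj(3) by simp
        then have "A1 = A2" using blk_eq[of "Lower 1" "Lower q"] qA d(2) assms(1) unfolding A1_def by simp
        then show ?thesis using A2(1) by simp
      next
        case b: (Lower y)
        have "same_block \<delta> (Upper p) (Lower p)" using x(2) diag_T by blast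
        moreover have "same_block \<delta> b d" using fbd blk_eq mem b d by (simp add: f_simps)
        moreover have "boundary_pos n (Upper p) < boundary_pos n b" using b c(2) by auto
        ultimately have "same_block \<delta> (Upper p) b"
          using planar less c(1) by blast
        then have "same_block \<delta> (Lower p) b"
          using \<open>same_block \<delta> (Upper p) (Lower p)\<close> same_block_sym same_block_trans[OF \<delta>] by blast
        then show ?thesis using fac blk_eq mem b c by (simp add: f_simps)
      qed
    qed
    then show "same_block \<alpha> a b" using mem unfolding sb by blast
  qed
  moreover have "same_block \<alpha> (Upper 1) (Lower 1)" unfolding sb f_simps A1_def using assms(1) by simp
  ultimately have \<alpha>M: "\<alpha> \<in> carrier (M_monoid n)" using \<alpha> unfolding carrier_M by blast
  have ker: "(1, 2) \<notin> ker \<alpha>" using upper_inj[of 1 2] unfolding ker_def sb by auto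
  let ?e = "partition_mult n (partition_mult n (star \<alpha>) (two_proj n 1 2)) \<alpha>"
  have eQ: "?e \<in> Q_set n" using two_proj_in_Q_set[of 1 2 n] assms(1) \<alpha>M by (intro conj_in_Q_set) auto
  have "?e = \<delta>"
  proof (rule projection_eqI[OF Q_setD(2-4)[OF eQ] proj])
    fix a b assume "a \<in> {1..n}" "b \<in> {1..n}"
    then show "same_block ?e (Lower a) (Lower b) \<longleftrightarrow> same_block \<delta> (Lower a) (Lower b)"
      using same_block_conj_two_proj(1)[OF \<alpha>, of 2 a b] blk_eq unfolding sb f_simps by simp
  next
    fix a assume a: "a \<in> {1..n}"
    have "same_block ?e (Upper a) (Lower a) \<longleftrightarrow> blk (Lower a) = A1 \<or> blk (Lower a) = A2"
      using same_block_conj_two_proj(2)[OF \<alpha>, of 2 a a] a assms(1) unfolding sb f_simps by auto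
    also have "\<dots> \<longleftrightarrow> blk (Lower a) \<in> T"
      using A1 A2 blk_self[of "Lower a"] a by auto
    also have "\<dots> \<longleftrightarrow> same_block \<delta> (Upper a) (Lower a)" by (rule diag_T)
    finally show "same_block ?e (Upper a) (Lower a) \<longleftrightarrow> same_block \<delta> (Upper a) (Lower a)" .
  qed
  then show ?thesis using that \<alpha>M ker by blast
qed

lemma Q_minus_orbit:
  assumes "n \<ge> 2"
  shows "Q_minus n = mu n (Some (two_proj n 1 2)) ` carrier (M_monoid n)"
proof
  have e: "two_proj n 1 2 \<in> Q_set n" using two_proj_in_Q_set[of 1 2 n] assms by simp
  have mu_e: "mu n (Some (two_proj n 1 2)) \<alpha> = (if (1, 2) \<notin> ker \<alpha>
      then Some (partition_mult n (partition_mult n (star \<alpha>) (two_proj n 1 2)) \<alpha>) else None)"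
    if "\<alpha> \<in> carrier (M_monoid n)" for \<alpha>
    using mu_Some[OF e] ker_two_proj_mult[OF partition_on_M[OF that], of 1 2] assms by simp
  show "mu n (Some (two_proj n 1 2)) ` carrier (M_monoid n) \<subseteq> Q_minus n"
    using mu_e conj_in_Q_set[OF e] unfolding Q_minus_def by auto
  show "Q_minus n \<subseteq> mu n (Some (two_proj n 1 2)) ` carrier (M_monoid n)"
  proof
    fix x assume x: "x \<in> Q_minus n"
    show "x \<in> mu n (Some (two_proj n 1 2)) ` carrier (M_monoid n)"
    proof (cases x)
      case None
      let ?\<alpha> = "fibres n (\<lambda>_. ())"
      have "?\<alpha> \<in> carrier (M_monoid n)"
        unfolding carrier_M planar_iff[OF partition_on_fibres] same_block_fibres
        using partition_on_fibres assms by auto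
      moreover have "(1, 2) \<in> ker ?\<alpha>" unfolding ker_def same_block_fibres using assms by simp
      ultimately show ?thesis using mu_e None by (intro image_eqI) auto
    next
      case (Some \<delta>)
      then have "\<delta> \<in> Q_set n" using x unfolding Q_minus_def by auto
      then obtain \<alpha> where "\<alpha> \<in> carrier (M_monoid n)" "(1, 2) \<notin> ker \<alpha>"
        "partition_mult n (partition_mult n (star \<alpha>) (two_proj n 1 2)) \<alpha> = \<delta>"
        using ex_conj_two_proj_eq[OF assms] by blast
      then show ?thesis using mu_e Some by (intro image_eqI[of _ _ \<alpha>]) auto
    qed
  qed
qed

lemma finite_carrier_M: "finite (carrier (M_monoid n))"
proof (rule finite_subset)
  show "carrier (M_monoid n) \<subseteq> Pow (Pow (vertices n))"
    using partition_on_M partition_onD1 by blast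
qed (simp add: finite_vertices)

theorem theorem5p4:
  fixes n :: nat
  assumes "n \<ge> 2"
  shows "monoid (M_monoid n) \<and>
         right_action (M_monoid n) (Q_minus n) (mu n) \<and>
         faithful (M_monoid n) (Q_minus n) (mu n) \<and>
         monogenic (M_monoid n) (Q_minus n) (mu n) \<and>
         deg (M_monoid n) \<le> deg_rc (M_monoid n) \<and>
         deg_rc (M_monoid n) \<le> 1 + card (Q_set n)"
proof -
  let ?M = "M_monoid n"
  let ?x = "Some (two_proj n 1 2)"
  have monoid: "monoid ?M" using monoid_M assms by simp
  have x: "?x \<in> Q_minus n" using two_proj_in_Q_set[of 1 2 n] assms unfolding Q_minus_def by simp
  note orbit = Q_minus_orbit[OF assms]
  have "Q_minus n = {?x} \<union> {mu n ?x \<alpha> | \<alpha>. \<alpha> \<in> carrier ?M}"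
    using x orbit by blast
  then have mono: "monogenic ?M (Q_minus n) (mu n)" unfolding monogenic_def using x by blast
  have finQ: "finite (Q_set n)"
    using finite_subset[OF _ finite_carrier_M[of n], of "Q_set n"] Q_setD(1) by blast
  then have fin: "finite (Q_minus n)" unfolding Q_minus_def by simp
  have "card (Q_minus n) = 1 + card (Q_set n)"
    unfolding Q_minus_def using finQ by (simp add: card_image)
  moreover obtain \<sigma> where \<sigma>: "right_congruence ?M \<sigma>"
    "faithful ?M (carrier ?M // \<sigma>) (class_action ?M \<sigma>)" "card (carrier ?M // \<sigma>) \<le> card (Q_minus n)"
    using ex_faithful_right_congruence[OF monoid right_action_mu faithful_mu fin x orbit] by blast
  moreover have "deg_rc ?M \<le> card (carrier ?M // \<sigma>)"
    unfolding deg_rc_def by (rule Least_le) (use \<sigma> in blast)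
  ultimately show ?thesis
    using monoid right_action_mu faithful_mu mono deg_le_deg_rc[OF monoid finite_carrier_M \<sigma>(1,2)]
    by simp
qed

end
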